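(* Let $\theta \in \left(\frac{2}{5}, \frac{3}{5}\right)$ be a constant for which there exists a constant $c_\theta>0$ such that, for all sufficiently large integers $k$, the open interval $(k, k+k^{\theta})$ contains at least $c_\theta \frac{k^{\theta}}{\log k}$ primes. Then there exists $k_0$ such that for all integers $k \ge k_0$ and all $n \in \mathbb{N}$ with $$2k < n \le \exp\left(\frac{(\log k)^2}{20 \log\log k}\right),$$ the product $(n-k)(n-k+1)\cdots(n-1)$ is divisible by some prime $p$ with $k < p < k + 3k^{\theta}$.
   Context: Here $\log$ is the natural logarithm. The product $(n-k)(n-k+1)\cdots(n-1)=\prod_{i=1}^{k}(n-i)$ is a product of $k$ consecutive integers. A constant $\theta$ with the stated property is known to exist (Baker, Harman and Pintz, 2001); the theorem is stated for such a fixed $\theta$, and the threshold $k_0$ may depend on $\theta$ (and $c_\theta$). *)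

theory Defs
  imports Complex_Main "HOL-Computational_Algebra.Primes"
begin

end

theory Submission
  imports Defs "HOL-Library.FuncSet" "HOL-Library.Discrete_Functions"
    "HOL-Computational_Algebra.Polynomial" "HOL-Real_Asymp.Real_Asymp"
begin

text \<open>Write \<open>Y = k powr \<theta>\<close>. If no prime \<open>p\<close> strictly between \<open>k\<close> and \<open>k + 3 * Y\<close> divides the product, then
for each such \<open>p\<close> the residue of \<open>n\<close> modulo \<open>p\<close> avoids \<open>1, \<dots>, k\<close>; hence the least multiple
\<open>a p * p\<close> that is at least \<open>n\<close> exceeds \<open>n\<close> by less than \<open>p - k < 3 * Y\<close>, and the integer \<open>a p\<close> is
within \<open>3 * Y / k\<close> of \<open>n / p\<close> (lemma \<open>multiple_above\<close>). The proof shows that the smooth function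
\<open>n / x\<close> cannot be that close to integers at so many points.

The tool is an integer relation on a short window. Let \<open>x + t\<close>, for \<open>t\<close> in a set \<open>T\<close> of \<open>2 * i + 1\<close>
elements of \<open>{0..m * q}\<close>, be primes. There are small integers \<open>c t\<close> with \<open>\<Sum>t\<in>T. c t * t ^ j = 0\<close> for
\<open>j < i\<close> and \<open>M = (\<Sum>t\<in>T. c t * (t choose i))\<close> positive (lemma \<open>exact_order_relation\<close>). Siegel's
pigeonhole argument yields a relation whose order of vanishing \<open>d\<close> is only known to lie between \<open>i\<close>
and \<open>2 * i\<close>; multiplying the coefficients by \<open>t choose (d - i)\<close> lowers the order to exactly \<open>i\<close>.
Applying the relation to the numbers \<open>a (x + t)\<close> gives an integer \<open>A\<close> with
\<open>A / M \<approx> n * fact i / x ^ (i + 1)\<close> (lemma \<open>window_relation\<close>). Here \<open>m\<close> is about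
\<open>ln k / (20 * ln (ln k))\<close>, \<open>q\<close> is a little more than \<open>ln k\<close>, and \<open>i \<le> m\<close>. Everything is of
the size of a bounded power of \<open>q ^ m\<close>, which is about \<open>k powr (1 / 20)\<close>: the sum of the \<open>\<bar>c t\<bar>\<close> is at most
\<open>k powr (8 / 100)\<close> and \<open>M\<close> at most \<open>k powr (13 / 100)\<close>. This is where the upper bound on \<open>n\<close>
enters.

The quantity \<open>scale n i k = n * fact i / k ^ (i + 1)\<close> is multiplied by \<open>(i + 1) / k\<close> in each step of \<open>i\<close>, so
some \<open>i \<le> m\<close> has \<open>scale n i k\<close> between \<open>k powr (- 30 / 100)\<close> and \<open>k powr (70 / 100)\<close>.
Four cases are excluded.

\<^item> Up to \<open>k powr (- 14 / 100)\<close>: the integer \<open>A\<close> is less than \<open>1\<close> in absolute value, so it is \<open>0\<close>,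
yet it is close to a number that exceeds the error (\<open>no_tiny_scale\<close>).

\<^item> From \<open>k powr (10 / 100)\<close> on: for two windows \<open>x\<close>, \<open>x'\<close> at a suitable distance the
fractions \<open>A / M\<close> and \<open>A' / M'\<close> differ, but by less than \<open>1 / (M * M')\<close>
(\<open>no_large_scale\<close>, by \<open>two_window_contradiction\<close>).

\<^item> In between, with \<open>i = j + 1\<close>: the fraction \<open>A / M\<close> is the same number \<open>v / w\<close> in all windows, as its
variation over the whole interval is too small to be nonzero. Adding \<open>v / w\<close> times suitable integers to the
relations of order \<open>j\<close> gives fractions that follow \<open>scale n j x + v * x / w\<close> up to a constant. The slope
of this function is small and changes at a known rate, so it is bounded away from \<open>0\<close> near one of the
two ends of the interval from \<open>k\<close> to \<open>k + 3 * Y\<close>, and there two windows are again compared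
(\<open>no_unit_scale\<close>).

\<^item> For \<open>i = 0\<close> and \<open>n / k \<le> k powr (10 / 100)\<close>: \<open>a p\<close> has the same value \<open>a \<ge> 2\<close> at a prime
\<open>p\<^sub>1 < k + Y\<close> and a prime \<open>p\<^sub>3 > k + 2 * Y\<close>. From \<open>a * p\<^sub>1 \<ge> n > a * p\<^sub>3 - (p\<^sub>3 - k)\<close> one gets
\<open>2 * (p\<^sub>3 - p\<^sub>1) < p\<^sub>3 - k\<close>, which is false for these positions (\<open>no_smallest_scale\<close>).\<close>

section \<open>Integer relations on a short window\<close>

lemma power_le_fact_exp:
  fixes x :: real assumes "x \<ge> 0" shows "x ^ j \<le> fact j * exp x"
proof -
  have s: "summable (\<lambda>i. x ^ i /\<^sub>R fact i)" using summable_exp_generic .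
  have "(\<Sum>i\<in>{j}. x ^ i /\<^sub>R fact i) \<le> (\<Sum>i. x ^ i /\<^sub>R fact i)"
    by (rule sum_le_suminf[OF s]) (use assms in auto)
  then show ?thesis by (simp add: exp_def field_simps)
qed

text \<open>Siegel's lemma with separate bounds for the rows: among the vectors with entries in \<open>{0..C}\<close> two have the same
image, since there are fewer images than vectors, and their difference is the solution.\<close>

lemma siegel:
  fixes T :: "'a set" and b :: "nat \<Rightarrow> 'a \<Rightarrow> nat"
  assumes T: "finite T" and b: "\<And>j t. j < i \<Longrightarrow> t \<in> T \<Longrightarrow> b j t \<le> \<beta> j"
    and less: "(\<Prod>j<i. card T * C * \<beta> j + 1) < (C + 1) ^ card T"
  obtains c :: "'a \<Rightarrow> int" where "\<exists>t\<in>T. c t \<noteq> 0" "\<And>t. t \<in> T \<Longrightarrow> \<bar>c t\<bar> \<le> int C"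
    "\<And>j. j < i \<Longrightarrow> (\<Sum>t\<in>T. c t * int (b j t)) = 0"
proof -
  define S where "S = PiE T (\<lambda>_. {0..C})"
  define F where "F = (\<lambda>u. \<lambda>j\<in>{..<i}. \<Sum>t\<in>T. u t * b j t)"
  have "F ` S \<subseteq> PiE {..<i} (\<lambda>j. {0..card T * C * \<beta> j})"
  proof (clarsimp simp: F_def)
    fix u j assume u: "u \<in> S" and j: "j < i"
    have "(\<Sum>t\<in>T. u t * b j t) \<le> (\<Sum>t\<in>T. C * \<beta> j)"
      by (rule sum_mono, rule mult_mono) (use u b[OF j] in \<open>auto simp: S_def PiE_def Pi_def\<close>)
    then show "(\<Sum>t\<in>T. u t * b j t) \<le> card T * C * \<beta> j" by simp
  qed
  then have "card (F ` S) \<le> card (PiE {..<i} (\<lambda>j. {0..card T * C * \<beta> j}))"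
    by (intro card_mono finite_PiE) auto
  also have "\<dots> = (\<Prod>j<i. card T * C * \<beta> j + 1)" by (simp add: card_PiE)
  also have "\<dots> < card S" using less T by (simp add: S_def card_PiE)
  finally have "\<not> inj_on F S" using pigeonhole by blast
  then obtain u v where uv: "u \<in> S" "v \<in> S" "F u = F v" "u \<noteq> v" by (auto simp: inj_on_def)
  define c where "c t = int (u t) - int (v t)" for t
  have "\<exists>t\<in>T. c t \<noteq> 0"
  proof (rule ccontr)
    assume "\<not> ?thesis"
    then have "u = v" using uv by (intro PiE_ext[of u T _ v]) (auto simp: c_def S_def)
    with uv show False by simp
  qed
  moreover have "\<bar>c t\<bar> \<le> int C" if "t \<in> T" for t
  proof -
    have "u t \<le> C" "v t \<le> C" using uv that by (auto simp: S_def PiE_def Pi_def)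
    then show ?thesis by (auto simp: c_def)
  qed
  moreover have "(\<Sum>t\<in>T. c t * int (b j t)) = 0" if "j < i" for j
  proof -
    have "(\<Sum>t\<in>T. u t * b j t) = (\<Sum>t\<in>T. v t * b j t)"
      using fun_cong[OF uv(3), of j] that by (simp add: F_def)
    then have "int (\<Sum>t\<in>T. u t * b j t) = int (\<Sum>t\<in>T. v t * b j t)" by simp
    then show ?thesis by (simp add: c_def left_diff_distrib sum_subtractf)
  qed
  ultimately show ?thesis using that by blast
qed

text \<open>Multiplication by \<open>t\<close> in the basis of binomial coefficients. It is the source of all relations between the mixed
moments below.\<close>

lemma choose_times_self:
  "of_nat (t choose j) * of_nat t = (of_nat (Suc j) * of_nat (t choose Suc j) + of_nat j * of_nat (t choose j) :: 'a :: comm_semiring_1)"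
proof -
  have "(t choose j) * t = Suc j * (t choose Suc j) + j * (t choose j)"
  proof (cases "j \<le> t")
    case True
    have "Suc j * (t choose Suc j) = (t - j) * (t choose j)"
      by (simp only: binomial_absorption binomial_absorb_comp)
    moreover have "(t - j) * (t choose j) + j * (t choose j) = (t choose j) * t"
      using True by (metis add_mult_distrib le_add_diff_inverse2 mult.commute)
    ultimately show ?thesis by simp
  qed (simp add: binomial_eq_0)
  then show ?thesis by (metis of_nat_add of_nat_mult)
qed

text \<open>The moments mix binomial coefficients and powers because both bases are needed: binomial coefficients keep the numbers
small, powers appear in the expansion of \<open>1 / (x + t)\<close>.\<close>

definition moment :: "nat set \<Rightarrow> (nat \<Rightarrow> int) \<Rightarrow> nat \<Rightarrow> nat \<Rightarrow> int" where
  "moment T c j s = (\<Sum>t\<in>T. c t * int (t choose j) * int t ^ s)"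

lemma moment_Suc: "moment T c j (Suc s) = int (Suc j) * moment T c (Suc j) s + int j * moment T c j s"
proof -
  have "moment T c j (Suc s) = (\<Sum>t\<in>T. c t * (int (t choose j) * int t) * int t ^ s)"
    by (simp add: moment_def mult_ac)
  also have "\<dots> = (\<Sum>t\<in>T. int (Suc j) * (c t * int (t choose Suc j) * int t ^ s) + int j * (c t * int (t choose j) * int t ^ s))"
    unfolding choose_times_self by (intro sum.cong) (auto simp: algebra_simps)
  also have "\<dots> = int (Suc j) * moment T c (Suc j) s + int j * moment T c j s"
    by (simp only: moment_def sum.distrib sum_distrib_left)
  finally show ?thesis .
qed

lemma moment_eq_0:
  assumes "\<And>j. j < i \<Longrightarrow> moment T c j 0 = 0" "j + s < i"
  shows "moment T c j s = 0"
  using assms(2) by (induction s arbitrary: j) (simp_all add: assms(1) moment_Suc)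

lemma moment_eq_0':
  assumes "\<And>s. s < i \<Longrightarrow> moment T c 0 s = 0" "j + s < i"
  shows "moment T c j s = 0"
  using assms(2)
proof (induction j arbitrary: s)
  case (Suc j)
  have "moment T c j (Suc s) = 0" "moment T c j s = 0" using Suc by auto
  then show ?case using moment_Suc[of T c j s] by simp
qed (simp add: assms(1))

text \<open>At the order of vanishing the moments in the two bases differ by factorials only.\<close>

lemma moment_lead:
  assumes "\<And>j. j < i \<Longrightarrow> moment T c j 0 = 0" "j + s = i"
  shows "fact j * moment T c j s = fact i * moment T c i 0"
  using assms(2)
proof (induction s arbitrary: j)
  case (Suc s)
  have "moment T c j s = 0" by (rule moment_eq_0[OF assms(1)]) (use Suc in auto)
  then have "fact j * moment T c j (Suc s) = fact (Suc j) * moment T c (Suc j) s"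
    by (simp add: moment_Suc)
  with Suc.IH[of "Suc j"] Suc.prems show ?case by simp
qed simp

text \<open>One step beyond the order of vanishing, the lower-order part of \<open>t ^ (i + 1)\<close> in the binomial basis still contributes
the leading moment.\<close>

lemma moment_second:
  assumes "\<And>j. j < i \<Longrightarrow> moment T c j 0 = 0" "j \<le> Suc i"
  shows "2 * fact j * moment T c j (Suc i - j) =
     2 * fact (Suc i) * moment T c (Suc i) 0 + fact i * moment T c i 0 * (int i * (int i + 1) - int j * (int j - 1))"
  using assms(2)
proof (induction rule: inc_induct)
  case (step j)
  have eq: "Suc i - j = Suc (i - j)" "Suc i - Suc j = i - j" using step by auto
  have "fact j * moment T c j (i - j) = fact i * moment T c i 0"
    by (rule moment_lead[OF assms(1)]) (use step in auto)
  then have "2 * fact j * moment T c j (Suc i - j) =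
      2 * fact (Suc j) * moment T c (Suc j) (Suc i - Suc j) + 2 * int j * (fact i * moment T c i 0)"
    unfolding eq moment_Suc by (simp add: algebra_simps)
  then show ?case unfolding step.IH by (simp add: algebra_simps)
qed (simp add: algebra_simps)

text \<open>Nonvanishing of the Vandermonde determinant: if all these moments vanished, the functional defined by \<open>c\<close> would kill
every polynomial of degree less than \<open>card T\<close>, among them the one that is zero on \<open>T\<close> except at \<open>t0\<close>.\<close>

lemma moment_nonzero:
  assumes "finite T" "t0 \<in> T" "c t0 \<noteq> 0"
  shows "\<exists>j<card T. moment T c j 0 \<noteq> 0"
proof (rule ccontr)
  assume "\<not> ?thesis"
  then have 0: "moment T c j 0 = 0" if "j < card T" for j using that by blast
  define P :: "int poly" where "P = (\<Prod>s\<in>T - {t0}. [:- int s, 1:])"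
  have deg: "degree P < card T"
  proof -
    have "degree P \<le> (\<Sum>s\<in>T - {t0}. degree [:- int s, 1:])" unfolding P_def
      by (rule order.trans[OF degree_prod_sum_le]) (use assms in auto)
    also have "\<dots> = card T - 1" using assms by simp
    also have "\<dots> < card T" using assms by (metis card_Diff1_less card_Diff_singleton)
    finally show ?thesis .
  qed
  have "(\<Sum>t\<in>T. c t * poly P (int t)) = (\<Sum>l\<le>degree P. coeff P l * moment T c 0 l)"
    unfolding poly_altdef moment_def sum_distrib_left by (subst sum.swap) (simp add: mult_ac)
  also have "\<dots> = 0"
    by (rule sum.neutral) (use deg in \<open>auto intro!: moment_eq_0[of "card T"] 0\<close>)
  finally have "(\<Sum>t\<in>T. c t * poly P (int t)) = 0" .
  moreover have "(\<Sum>t\<in>T. c t * poly P (int t)) = c t0 * poly P (int t0)"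
  proof -
    have "(\<Sum>t\<in>T. c t * poly P (int t)) = (\<Sum>t\<in>{t0}. c t * poly P (int t))"
    proof (rule sum.mono_neutral_right)
      show "\<forall>t\<in>T - {t0}. c t * poly P (int t) = 0"
        using assms by (auto simp: P_def poly_prod)
    qed (use assms in auto)
    then show ?thesis by simp
  qed
  moreover have "poly P (int t0) \<noteq> 0" using assms by (simp add: P_def poly_prod)
  ultimately show False using assms by simp
qed

text \<open>A bound for \<open>t choose j\<close> with \<open>t \<le> m * q\<close> and \<open>j \<le> m\<close>. The window length is written as a product
\<open>m * q\<close> so that the division by \<open>fact j\<close> removes the factor \<open>m ^ j\<close> at the cost of \<open>exp m\<close>.\<close>

definition growth :: "nat \<Rightarrow> nat \<Rightarrow> real" where
  "growth m q = exp (real m) * real q ^ m"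

text \<open>A bound for the sum of the \<open>\<bar>c t\<bar>\<close> over a relation: up to the number of points, the factor with \<open>sqrt q\<close> comes from
Siegel's lemma and \<open>growth m q\<close> from the correction of the order.\<close>

definition weight :: "nat \<Rightarrow> nat \<Rightarrow> real" where
  "weight m q = 2 * real (2 * m + 1) ^ 2 * exp (real m) * sqrt (real q) ^ m * growth m q"

lemma power_le_growth:
  assumes "j \<le> m" "real t \<le> real m * real q"
  shows "real t ^ j \<le> fact j * (exp (real m) * real q ^ j)"
proof -
  have "real t ^ j \<le> (real m * real q) ^ j" using assms by (intro power_mono) auto
  also have "\<dots> = real m ^ j * real q ^ j" by (simp add: power_mult_distrib)
  also have "\<dots> \<le> (fact j * exp (real m)) * real q ^ j"
    by (intro mult_right_mono power_le_fact_exp) auto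
  finally show ?thesis by (simp add: mult_ac)
qed

lemma choose_le_growth:
  assumes "j \<le> m" "t \<le> m * q"
  shows "real (t choose j) \<le> exp (real m) * real q ^ j"
proof -
  have "real (t choose j) * fact j \<le> real t ^ j"
    using binomial_fact_pow[of t j] by (metis of_nat_fact of_nat_le_iff of_nat_mult of_nat_power)
  also have "\<dots> \<le> fact j * (exp (real m) * real q ^ j)"
    by (rule power_le_growth) (use assms in \<open>simp_all flip: of_nat_mult\<close>)
  finally show ?thesis by (simp add: mult.commute)
qed

lemma power_le_growth_top:
  assumes "j \<le> m" "1 \<le> q" shows "exp (real m) * real q ^ j \<le> growth m q"
  unfolding growth_def using assms by (intro mult_left_mono power_increasing) auto

lemma growth_ge_1: "1 \<le> q \<Longrightarrow> 1 \<le> growth m q"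
  unfolding growth_def using mult_mono[of 1 "exp (real m)" 1 "real q ^ m"] by (simp add: one_le_power)

lemma weight_ge_1: assumes "1 \<le> q" shows "1 \<le> weight m q"
proof -
  have "1 * 1 * 1 * 1 * 1 \<le> weight m q" unfolding weight_def
    using assms growth_ge_1[OF assms, of m] by (intro mult_mono) (auto simp: one_le_power)
  then show ?thesis by simp
qed

lemma prod_power_sum: "(\<Prod>j<i. a * (r::real) ^ j) ^ 2 = a ^ (2 * i) * r ^ (i * (i - 1))"
proof (induction i)
  case (Suc i)
  have e: "i * (i - 1) + 2 * i = Suc i * (Suc i - 1)" by (cases i) auto
  have "(\<Prod>j<Suc i. a * r ^ j) ^ 2 = (a ^ (2 * i) * r ^ (i * (i - 1))) * (a * r ^ i) ^ 2"
    unfolding prod.lessThan_Suc power_mult_distrib[of _ "a * r ^ i"] Suc.IH ..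
  also have "\<dots> = a ^ (2 * Suc i) * r ^ (i * (i - 1) + 2 * i)"
    by (simp add: power_mult_distrib power_add power_even_eq power2_eq_square power_mult mult_ac)
  finally show ?case by (simp only: e)
qed simp

text \<open>With \<open>2 * i + 1\<close> unknowns for \<open>i\<close> equations the exponent in Siegel's lemma is at most \<open>1\<close>. The row bounds multiply
to about \<open>q ^ (i * (i - 1) div 2)\<close>, whose \<open>i\<close>-th root is at most \<open>sqrt q ^ m\<close>.\<close>

lemma small_relation:
  assumes T: "T \<subseteq> {..m * q}" "card T = 2 * i + 1" and "i \<le> m" "1 \<le> q"
  obtains c :: "nat \<Rightarrow> int" where "\<exists>t\<in>T. c t \<noteq> 0" "\<And>j. j < i \<Longrightarrow> moment T c j 0 = 0"
    "\<And>t. t \<in> T \<Longrightarrow> \<bar>real_of_int (c t)\<bar> \<le> 2 * real (2 * m + 1) * exp (real m) * sqrt (real q) ^ m"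
proof -
  have fin: "finite T" using T finite_subset by blast
  define J where "J = 2 * i + 1"
  define e where "e = exp (real m)"
  have e1: "e \<ge> 1" by (simp add: e_def)
  define C0 where "C0 = 2 * real (2 * m + 1) * e * sqrt (real q) ^ m"
  define C where "C = nat \<lfloor>C0\<rfloor>"
  define \<beta> where "\<beta> j = nat \<lfloor>e * real q ^ j\<rfloor>" for j
  have sq: "sqrt (real q) ^ m \<ge> 1" using \<open>1 \<le> q\<close> by (simp add: one_le_power)
  have C01: "C0 \<ge> 1"
  proof -
    have "1 * 1 * 1 * 1 \<le> C0" unfolding C0_def by (intro mult_mono) (use e1 sq in auto)
    then show ?thesis by simp
  qed
  have C1: "1 \<le> C" "real C \<le> C0" "C0 < real C + 1" using C01 unfolding C_def by linarith+
  have \<beta>: "real (\<beta> j) \<le> e * real q ^ j" for j using e1 unfolding \<beta>_def by simp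
  have main: "(\<Prod>j<i. card T * C * \<beta> j + 1) < (C + 1) ^ card T"
  proof -
    define a where "a = 2 * real J * real C * e"
    have a0: "a \<ge> 0" using e1 by (simp add: a_def)
    have "real (\<Prod>j<i. card T * C * \<beta> j + 1) \<le> (\<Prod>j<i. a * real q ^ j)"
      unfolding of_nat_prod
    proof (intro prod_mono conjI)
      fix j
      have "1 * 1 * 1 * 1 \<le> real J * real C * e * real q ^ j"
        by (intro mult_mono) (use e1 C1 \<open>1 \<le> q\<close> in \<open>auto simp: J_def one_le_power\<close>)
      moreover have "real J * real C * real (\<beta> j) \<le> real J * real C * (e * real q ^ j)"
        by (intro mult_left_mono \<beta>) auto
      moreover have "real (card T * C * \<beta> j + 1) = real J * real C * real (\<beta> j) + 1"
        by (simp only: T(2) J_def of_nat_add of_nat_mult of_nat_1)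
      moreover have "a * real q ^ j = 2 * (real J * real C * (e * real q ^ j))" by (simp add: a_def)
      ultimately show "real (card T * C * \<beta> j + 1) \<le> a * real q ^ j" by linarith
    qed auto
    also have "\<dots> < (real C + 1) ^ J"
    proof (rule power2_less_imp_less)
      have "(\<Prod>j<i. a * real q ^ j)\<^sup>2 = a ^ (2 * i) * real q ^ (i * (i - 1))" by (rule prod_power_sum)
      also have "\<dots> \<le> a ^ (2 * i) * real q ^ (i * m)"
        using a0 assms by (intro mult_left_mono power_increasing mult_le_mono) auto
      also have "real q ^ (i * m) = (sqrt (real q) ^ m) ^ (2 * i)"
        by (metis mult.commute of_nat_0_le_iff power_mult real_sqrt_pow2)
      also have "a ^ (2 * i) * (sqrt (real q) ^ m) ^ (2 * i) = (2 * real J * e * sqrt (real q) ^ m * real C) ^ (2 * i)"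
        by (simp add: a_def power_mult_distrib mult_ac)
      also have "\<dots> \<le> ((real C + 1) * (real C + 1)) ^ (2 * i)"
      proof (intro power_mono mult_mono)
        have "2 * real J * e * sqrt (real q) ^ m \<le> C0"
          unfolding C0_def J_def using assms e1 sq by (intro mult_right_mono) auto
        then show "2 * real J * e * sqrt (real q) ^ m \<le> real C + 1" using C1 by linarith
      qed (use e1 in auto)
      also have "\<dots> = (real C + 1) ^ (4 * i)" by (simp flip: power2_eq_square power_mult)
      also have "\<dots> < (real C + 1) ^ (J * 2)"
        by (intro power_strict_increasing) (use C1 in \<open>auto simp: J_def\<close>)
      finally show "(\<Prod>j<i. a * real q ^ j)\<^sup>2 < ((real C + 1) ^ J)\<^sup>2" by (simp only: power_mult)
    qed auto
    finally have "real (\<Prod>j<i. card T * C * \<beta> j + 1) < real ((C + 1) ^ card T)"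
      by (simp only: T(2) J_def of_nat_power of_nat_add of_nat_1)
    then show ?thesis by (simp only: of_nat_less_iff)
  qed
  have "t choose j \<le> \<beta> j" if "j < i" "t \<in> T" for j t
  proof -
    have "real (t choose j) \<le> e * real q ^ j"
      unfolding e_def by (rule choose_le_growth) (use that assms in auto)
    then show ?thesis unfolding \<beta>_def by (simp add: le_nat_iff le_floor_iff)
  qed
  then obtain c :: "nat \<Rightarrow> int" where c: "\<exists>t\<in>T. c t \<noteq> 0" "\<And>t. t \<in> T \<Longrightarrow> \<bar>c t\<bar> \<le> int C"
    "\<And>j. j < i \<Longrightarrow> (\<Sum>t\<in>T. c t * int (t choose j)) = 0"
    using siegel[OF fin, of i "\<lambda>j t. t choose j" \<beta> C] main by blast
  show ?thesis
  proof
    show "\<bar>real_of_int (c t)\<bar> \<le> 2 * real (2 * m + 1) * exp (real m) * sqrt (real q) ^ m" if "t \<in> T" for t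
    proof -
      have "\<bar>real_of_int (c t)\<bar> = real_of_int \<bar>c t\<bar>" by simp
      also have "\<dots> \<le> real C" using c(2)[OF that] by (metis of_int_le_iff of_int_of_nat_eq)
      also have "\<dots> \<le> C0" by (rule C1)
      finally show ?thesis by (simp add: C0_def e_def)
    qed
  qed (use c in \<open>auto simp: moment_def\<close>)
qed

text \<open>The exact order matters: a relation that vanishes to higher order than wanted would make the main term of
\<open>\<Sum>t\<in>T. c t / (x + t)\<close> uncontrollably small. Multiplication of the coefficients by a polynomial of degree \<open>r\<close> lowers the
order by exactly \<open>r\<close>, and the order found is at most \<open>2 * i\<close> because there are \<open>2 * i + 1\<close> points.\<close>

lemma exact_order_relation:
  assumes T: "T \<subseteq> {..m * q}" "card T = 2 * i + 1" and im: "i \<le> m" "1 \<le> q"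
  obtains c :: "nat \<Rightarrow> int" where "\<And>j. j < i \<Longrightarrow> moment T c 0 j = 0" "moment T c i 0 > 0"
    "(\<Sum>t\<in>T. \<bar>real_of_int (c t)\<bar>) \<le> weight m q"
proof -
  have fin: "finite T" using T finite_subset by blast
  define K where "K = 2 * real (2 * m + 1) * exp (real m) * sqrt (real q) ^ m"
  obtain b :: "nat \<Rightarrow> int" where b: "\<exists>t\<in>T. b t \<noteq> 0" "\<And>j. j < i \<Longrightarrow> moment T b j 0 = 0"
    "\<And>t. t \<in> T \<Longrightarrow> \<bar>real_of_int (b t)\<bar> \<le> K"
    using small_relation[OF assms] unfolding K_def by blast
  \<comment> \<open>the order of vanishing of the relation found by pigeonhole\<close>
  define d where "d = (LEAST j. moment T b j 0 \<noteq> 0)"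
  obtain j where j: "j < card T" "moment T b j 0 \<noteq> 0" using moment_nonzero[OF fin] b(1) by blast
  have d0: "moment T b d 0 \<noteq> 0" unfolding d_def using j(2) by (rule LeastI)
  have "d \<le> j" unfolding d_def using j(2) by (rule Least_le)
  then have d2: "d \<le> 2 * i" using j T by simp
  have di: "i \<le> d" using d0 b(2)[of d] by (meson not_le)
  have dv: "moment T b j 0 = 0" if "j < d" for j using that unfolding d_def by (metis not_less_Least)
  define r where "r = d - i"
  have r: "r \<le> i" "r + i = d" using d2 di by (auto simp: r_def)
  define c0 where "c0 t = b t * int (t choose r)" for t
  have c0m: "moment T c0 0 j = moment T b r j" for j by (simp add: moment_def c0_def)
  have c0_van: "moment T c0 0 j = 0" if "j < i" for j
    unfolding c0m by (rule moment_eq_0[OF dv]) (use that r in auto)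
  have c0_van': "moment T c0 j 0 = 0" if "j < i" for j
    by (rule moment_eq_0'[OF c0_van]) (use that in auto)
  have "fact r * moment T b r i = fact d * moment T b d 0"
    by (rule moment_lead[OF dv r(2)])
  then have "moment T c0 0 i \<noteq> 0" using d0 by (auto simp: c0m)
  moreover have "fact 0 * moment T c0 0 i = fact i * moment T c0 i 0"
    by (rule moment_lead[OF c0_van']) auto
  ultimately have ne: "moment T c0 i 0 \<noteq> 0" by auto
  define \<epsilon> where "\<epsilon> = sgn (moment T c0 i 0)"
  define c where "c t = \<epsilon> * c0 t" for t
  have cm: "moment T c j s = \<epsilon> * moment T c0 j s" for j s
    by (simp add: moment_def c_def sum_distrib_left mult_ac)
  have eps: "\<bar>\<epsilon>\<bar> = 1" using ne by (simp add: \<epsilon>_def abs_sgn_eq)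
  show ?thesis
  proof
    show "moment T c 0 j = 0" if "j < i" for j using that by (simp add: cm c0_van)
    show "moment T c i 0 > 0" using ne unfolding cm \<epsilon>_def by (simp add: sgn_mult_self_eq flip: abs_sgn mult.commute)
    have "(\<Sum>t\<in>T. \<bar>real_of_int (c t)\<bar>) \<le> (\<Sum>t\<in>T. K * growth m q)"
    proof (rule sum_mono)
      fix t assume t: "t \<in> T"
      have "\<bar>real_of_int (c t)\<bar> = \<bar>real_of_int (b t)\<bar> * real (t choose r)"
        using eps by (simp add: c_def c0_def abs_mult flip: of_int_abs)
      also have "\<dots> \<le> K * growth m q"
      proof (rule mult_mono[OF b(3)[OF t]])
        have "real (t choose r) \<le> exp (real m) * real q ^ r"
          by (rule choose_le_growth) (use r T t im in auto)
        also have "\<dots> \<le> growth m q" by (rule power_le_growth_top) (use r im in auto)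
        finally show "real (t choose r) \<le> growth m q" .
      qed (auto simp: K_def)
      finally show "\<bar>real_of_int (c t)\<bar> \<le> K * growth m q" .
    qed
    also have "\<dots> = real (2 * i + 1) * (K * growth m q)" using T by simp
    also have "\<dots> \<le> real (2 * m + 1) * (K * growth m q)"
      using im growth_ge_1[of q m] by (intro mult_right_mono) (auto simp: K_def)
    also have "\<dots> = weight m q" by (simp add: K_def weight_def power2_eq_square mult_ac)
    finally show "(\<Sum>t\<in>T. \<bar>real_of_int (c t)\<bar>) \<le> weight m q" .
  qed
qed

section \<open>Comparing two windows\<close>

lemma pigeonhole_average:
  assumes "finite A" "finite I" "f ` A \<subseteq> I" "A \<noteq> {}"
  obtains i where "i \<in> I" "real (card {a \<in> A. f a = i}) \<ge> real (card A) / real (card I)"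
proof -
  have "I \<noteq> {}" using assms by blast
  have "(\<Sum>i\<in>I. real (card {a \<in> A. f a = i})) = real (card A)"
    using sum.group[OF assms(1-3), of "\<lambda>_. 1::real"] by simp
  moreover have "(\<Sum>i\<in>I. real (card A) / real (card I)) = real (card A)"
    using \<open>I \<noteq> {}\<close> assms by simp
  ultimately have "\<not> (\<forall>i\<in>I. real (card {a \<in> A. f a = i}) < real (card A) / real (card I))"
    using sum_strict_mono[of I "\<lambda>i. real (card {a \<in> A. f a = i})" "\<lambda>_. real (card A) / real (card I)"] 
      \<open>I \<noteq> {}\<close> assms(2) by auto
  then show ?thesis using that by (meson not_le)
qed

text \<open>A subset of positive density \<open>\<kappa>\<close> in an interval of length \<open>Y\<close> has, on every scale \<open>H\<close>, two points whose distance is \<open>H\<close> up to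
the factor \<open>\<kappa> / 4\<close>: some piece of length \<open>H\<close> contains its share of the set, and its extreme points work.\<close>

lemma close_pair:
  fixes \<Omega> :: "nat set" and Y H :: real
  assumes fin: "finite \<Omega>" and range: "\<And>x x'. x \<in> \<Omega> \<Longrightarrow> x' \<in> \<Omega> \<Longrightarrow> real x - real x' \<le> Y"
    and H: "0 < H" "H \<le> Y" and card: "real (card \<Omega>) \<ge> \<kappa> * Y" "\<kappa> * H \<ge> 4"
  obtains x x' where "x \<in> \<Omega>" "x' \<in> \<Omega>" "\<kappa> * H / 4 \<le> real x' - real x" "real x' - real x \<le> H"
proof -
  have kY: "\<kappa> * Y \<ge> 4"
  proof -
    have "\<kappa> > 0" using card(2) H by (smt (verit) mult_nonpos_nonneg)
    then have "\<kappa> * H \<le> \<kappa> * Y" using H by simp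
    then show ?thesis using card by linarith
  qed
  have ne: "\<Omega> \<noteq> {}" using card kY by auto
  define x0 where "x0 = Min \<Omega>"
  have x0: "x0 \<in> \<Omega>" "\<And>x. x \<in> \<Omega> \<Longrightarrow> x0 \<le> x" unfolding x0_def using fin ne by auto
  define f where "f x = nat \<lfloor>(real x - real x0) / H\<rfloor>" for x
  define R where "R = nat \<lfloor>Y / H\<rfloor>"
  have fR: "f ` \<Omega> \<subseteq> {..R}"
  proof (clarsimp simp: f_def R_def)
    fix x assume "x \<in> \<Omega>"
    then have "(real x - real x0) / H \<le> Y / H" using range x0 H by (intro divide_right_mono) auto
    then show "nat \<lfloor>(real x - real x0) / H\<rfloor> \<le> nat \<lfloor>Y / H\<rfloor>" by (intro nat_mono floor_mono)
  qed
  obtain r where r: "real (card {x \<in> \<Omega>. f x = r}) \<ge> real (card \<Omega>) / real (card {..R})"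
    using pigeonhole_average[OF fin _ fR ne] by auto
  have "real (card {..R}) \<le> 2 * (Y / H)"
  proof -
    have "1 \<le> Y / H" using H by simp
    moreover have "real R \<le> Y / H" unfolding R_def using H by simp
    ultimately show ?thesis by simp
  qed
  then have "\<kappa> * H / 2 \<le> real (card \<Omega>) / real (card {..R})"
  proof -
    assume *: "real (card {..R}) \<le> 2 * (Y / H)"
    have "\<kappa> * H / 2 * real (card {..R}) \<le> \<kappa> * H / 2 * (2 * (Y / H))"
      using * card by (intro mult_left_mono) auto
    also have "\<dots> = \<kappa> * Y" using H by simp
    also have "\<dots> \<le> real (card \<Omega>)" by (rule card)
    finally show ?thesis by (simp add: field_simps)
  qed
  with r have big: "\<kappa> * H / 2 \<le> real (card {x \<in> \<Omega>. f x = r})" by linarith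
  define S where "S = {x \<in> \<Omega>. f x = r}"
  have S: "finite S" "S \<noteq> {}" using big card fin unfolding S_def by (auto simp del: Collect_empty_eq)
  have minmax: "Min S \<in> S" "Max S \<in> S" using S by auto
  have "S \<subseteq> {Min S..Max S}" using S by auto
  then have "card S \<le> Suc (Max S) - Min S" using card_mono[of "{Min S..Max S}" S] by simp
  then have spread: "real (card S) \<le> real (Max S) - real (Min S) + 1"
    using Min_le[OF S(1) minmax(2)] by linarith
  show ?thesis
  proof
    show "Min S \<in> \<Omega>" "Max S \<in> \<Omega>" using minmax by (auto simp: S_def)
    show "\<kappa> * H / 4 \<le> real (Max S) - real (Min S)" using spread big card unfolding S_def by linarith
    have a: "\<lfloor>(real x - real x0) / H\<rfloor> = int r" if "x \<in> S" for x
    proof -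
      have "x \<in> \<Omega>" "f x = r" using that by (auto simp: S_def)
      moreover have "(real x - real x0) / H \<ge> 0" using x0(2)[OF \<open>x \<in> \<Omega>\<close>] H by simp
      ultimately show ?thesis by (metis f_def nat_0_le zero_le_floor)
    qed
    have "(real (Max S) - real x0) / H \<le> r + 1" "r \<le> (real (Min S) - real x0) / H"
      using a[OF minmax(1)] a[OF minmax(2)] by linarith+
    then show "real (Max S) - real (Min S) \<le> H" using H by (simp add: field_simps)
  qed
qed

text \<open>Two fractions \<open>A x / M x\<close> with denominators of size about \<open>B\<close> are equal or differ by at least \<open>1 / (4 * B\<^sup>2)\<close>. They follow
\<open>G\<close> up to \<open>\<tau> / B\<close>, so two windows are sought for which the difference of \<open>G\<close> lies strictly between these two numbers.
The denominators are first restricted to one dyadic range: then it is enough that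
\<open>\<tau> * \<mu>\<close> is small, whereas unrelated denominators would require \<open>\<tau> * \<mu>\<^sup>2\<close> to be small.\<close>

lemma two_window_contradiction:
  fixes \<Omega> :: "nat set" and A M :: "nat \<Rightarrow> int" and G :: "nat \<Rightarrow> real"
  assumes fin: "finite \<Omega>" and range: "\<And>x x'. x \<in> \<Omega> \<Longrightarrow> x' \<in> \<Omega> \<Longrightarrow> real x - real x' \<le> Y"
    and card: "real (card \<Omega>) \<ge> \<rho> * Y"
    and M: "\<And>x. x \<in> \<Omega> \<Longrightarrow> 1 \<le> M x" "\<And>x. x \<in> \<Omega> \<Longrightarrow> real_of_int (M x) \<le> \<mu>" and D: "\<mu> < 2 ^ D"
    and approx: "\<And>x. x \<in> \<Omega> \<Longrightarrow> \<bar>A x - M x * G x\<bar> \<le> \<tau>"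
    and slope: "\<And>x x'. x \<in> \<Omega> \<Longrightarrow> x' \<in> \<Omega> \<Longrightarrow> x < x' \<Longrightarrow>
        s * (real x' - real x) \<le> \<bar>G x' - G x\<bar> \<and> \<bar>G x' - G x\<bar> \<le> 16 * s * (real x' - real x)"
    and pos: "0 < s" "0 < \<rho>" "\<rho> \<le> 1" "0 < Y" "1 \<le> \<mu>" "0 < \<tau>"
    and c1: "s * \<rho> * Y > 16 * D * \<tau>" and c2: "\<rho> > 4096 * D * \<mu> * \<tau>"
    and c3: "\<rho> \<ge> 1024 * D * s * \<mu>^2" and c4: "\<rho> * Y \<ge> 4 * D"
  shows False
proof -
  have D1: "D \<ge> 1" using D pos by (cases D) auto
  have "0 < real (card \<Omega>)" using card mult_pos_pos[OF pos(2) pos(4)] by linarith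
  then have ne: "\<Omega> \<noteq> {}" by auto
  define d where "d x = floor_log (nat (M x))" for x
  have d: "2 ^ d x \<le> M x \<and> M x < 2 * 2 ^ d x \<and> d x < D" if "x \<in> \<Omega>" for x
  proof -
    have "nat (M x) > 0" using M(1)[OF that] by simp
    from floor_log_exp2_le[OF this] floor_log_exp2_gt[of "nat (M x)"]
    have *: "2 ^ d x \<le> nat (M x)" "nat (M x) < 2 * 2 ^ d x" unfolding d_def by auto
    then have **: "2 ^ d x \<le> M x" "M x < 2 * 2 ^ d x" using M(1)[OF that] by (auto simp: nat_less_iff le_nat_iff)
    have "real_of_int (2 ^ d x) \<le> real_of_int (M x)" using ** by (simp only: of_int_le_iff)
    then have "real_of_int (2 ^ d x) < 2 ^ D" using M(2)[OF that] D by linarith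
    then have "d x < D" by simp
    with ** show ?thesis by simp
  qed
  obtain j where j: "j \<in> {..<D}" "real (card {x \<in> \<Omega>. d x = j}) \<ge> real (card \<Omega>) / real (card {..<D})"
    using pigeonhole_average[OF fin finite_lessThan, of d D] d ne by blast
  define S where "S = {x \<in> \<Omega>. d x = j}"
  define B :: real where "B = 2 ^ j"
  define \<kappa> where "\<kappa> = \<rho> / D"
  have B1: "B \<ge> 1" unfolding B_def by simp
  have MB: "B \<le> M x" "M x \<le> 2 * B" if "x \<in> S" for x
  proof -
    have "2 ^ j \<le> M x" "M x \<le> 2 * 2 ^ j" using d[of x] that by (auto simp: S_def)
    then have "real_of_int (2 ^ j) \<le> M x" "M x \<le> real_of_int (2 * 2 ^ j)" by (simp_all only: of_int_le_iff)
    then show "B \<le> M x" "M x \<le> 2 * B" by (simp_all add: B_def)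
  qed
  have cardS: "real (card S) \<ge> \<kappa> * Y"
  proof -
    have "\<kappa> * Y = \<rho> * Y / D" by (simp add: \<kappa>_def)
    also have "\<dots> \<le> real (card \<Omega>) / D" using card by (intro divide_right_mono) auto
    also have "\<dots> \<le> real (card S)" using j by (simp add: S_def)
    finally show ?thesis .
  qed
  have kp: "\<kappa> > 0" using pos D1 by (simp add: \<kappa>_def)
  have "0 < real (card S)" using cardS mult_pos_pos[OF kp pos(4)] by linarith
  then have "S \<noteq> {}" by auto
  then obtain y where "y \<in> S" by blast
  have B\<mu>: "B \<le> \<mu>" using MB(1)[OF \<open>y \<in> S\<close>] M(2)[of y] \<open>y \<in> S\<close> unfolding S_def by fastforce
  \<comment> \<open>the largest distance up to \<open>Y\<close> for which the slope bound limits the change of \<open>G\<close> to \<open>1 / (16 * B\<^sup>2)\<close>\<close>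
  define H where "H = min Y (1 / (256 * s * B^2))"
  have H: "0 < H" "H \<le> Y" using pos B1 by (auto simp: H_def)
  have kH: "\<kappa> * H \<ge> 4"
  proof (cases "H = Y")
    case True then show ?thesis using c4 D1 by (simp add: \<kappa>_def field_simps)
  next
    case False
    then have "H = 1 / (256 * s * B^2)" by (auto simp: H_def min_def split: if_splits)
    moreover have "1024 * D * s * B^2 \<le> \<rho>"
    proof -
      have "1024 * D * s * B^2 \<le> 1024 * D * s * \<mu>^2" using B\<mu> B1 pos by (intro mult_left_mono power_mono) auto
      then show ?thesis using c3 by linarith
    qed
    ultimately have "1024 * D * s * B^2 * H \<le> \<rho> * H" "H * (256 * s * B^2) = 1"
      using H pos B1 by (auto intro: mult_right_mono simp del: times_divide_eq_right)
    moreover have "1024 * D * s * B^2 * H = 4 * D * (H * (256 * s * B^2))" by simp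
    ultimately have "4 * D \<le> \<rho> * H" by (simp only: mult_1_right)
    then show ?thesis using D1 by (simp add: \<kappa>_def field_simps)
  qed
  have fS: "finite S" using fin by (simp add: S_def)
  obtain x x' where x: "x \<in> S" "x' \<in> S" "\<kappa> * H / 4 \<le> real x' - real x" "real x' - real x \<le> H"
    using close_pair[OF fS _ H cardS kH] range unfolding S_def by (smt (verit, ccfv_SIG) mem_Collect_eq)
  define h where "h = real x' - real x"
  have h: "h \<ge> 1" "x < x'" using x kH by (auto simp: h_def)
  have sl: "s * h \<le> \<bar>G x' - G x\<bar>" "\<bar>G x' - G x\<bar> \<le> 16 * s * h"
    using slope[of x x'] x h by (auto simp: h_def S_def)
  define p where "p = real_of_int (M x) * real_of_int (M x')"
  have MM: "B^2 \<le> p" "p \<le> 4 * B^2"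
    using mult_mono[OF MB(1)[OF x(1)] MB(1)[OF x(2)]] mult_mono[OF MB(2)[OF x(1)] MB(2)[OF x(2)]]
      MB[OF x(1)] MB[OF x(2)] B1 by (auto simp: power2_eq_square p_def)
  \<comment> \<open>the integer \<open>A x' * M x - A x * M x'\<close> will be seen to vanish, which leaves only \<open>E\<close> to balance the change of \<open>G\<close>\<close>
  define E where "E = (A x' * M x - A x * M x') - p * (G x' - G x)"
  have E: "\<bar>E\<bar> \<le> 4 * B * \<tau>"
  proof -
    have "E = M x * (A x' - M x' * G x') - M x' * (A x - M x * G x)" by (simp add: E_def p_def algebra_simps)
    then have "\<bar>E\<bar> \<le> \<bar>M x * (A x' - M x' * G x')\<bar> + \<bar>M x' * (A x - M x * G x)\<bar>" by linarith
    also have "\<dots> \<le> 2 * B * \<tau> + 2 * B * \<tau>" unfolding abs_mult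
      using MB[OF x(1)] MB[OF x(2)] approx[of x] approx[of x'] x(1,2) B1 by (intro add_mono mult_mono) (auto simp: S_def)
    finally show ?thesis by simp
  qed
  have bt: "4 * B * \<tau> < 1 / 2"
  proof -
    have "4096 * 1 * B * \<tau> \<le> 4096 * D * \<mu> * \<tau>" using B\<mu> B1 D1 pos by (intro mult_right_mono mult_mono) auto
    then show ?thesis using c2 pos by linarith
  qed
  have prodabs: "\<bar>p * (G x' - G x)\<bar> = p * \<bar>G x' - G x\<bar>"
    using order.trans[OF zero_le_power2 MM(1)] by (simp add: abs_mult)
  have "p * \<bar>G x' - G x\<bar> \<le> 4 * B^2 * (16 * s * H)"
    using MM sl x(4) pos h B1 unfolding h_def[symmetric]
    by (intro mult_mono) (auto intro: order.trans[OF sl(2)])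
  also have "\<dots> \<le> 4 * B^2 * (16 * s * (1 / (256 * s * B^2)))"
    using pos by (intro mult_left_mono) (auto simp: H_def)
  also have "\<dots> = 1 / 4" using pos B1 by simp
  finally have up: "p * \<bar>G x' - G x\<bar> \<le> 1 / 4" .
  have "\<bar>real_of_int (A x' * M x - A x * M x')\<bar> < 1"
    using E up prodabs bt unfolding E_def by linarith
  then have "A x' * M x - A x * M x' = 0" by linarith
  then have z: "real_of_int (A x' * M x - A x * M x') = 0" by (simp only: of_int_0)
  then have "p * \<bar>G x' - G x\<bar> \<le> 4 * B * \<tau>"
    using E prodabs unfolding E_def by linarith
  moreover have "B^2 * (s * h) \<le> p * \<bar>G x' - G x\<bar>" using MM sl pos h by (intro mult_mono) auto
  ultimately have "B * (B * (s * h)) \<le> B * (4 * \<tau>)" by (simp add: power2_eq_square mult_ac)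
  then have fin1: "B * (s * h) \<le> 4 * \<tau>" using B1 by simp
  have "B * (s * (\<kappa> * H / 4)) \<le> B * (s * h)" using x(3) pos B1 unfolding h_def[symmetric] by (intro mult_left_mono) auto
  then have fin2: "B * s * \<kappa> * H \<le> 16 * \<tau>" using fin1 by linarith
  show False
  proof (cases "H = Y")
    case True
    have "1 * (s * \<kappa> * Y) \<le> B * (s * \<kappa> * Y)" using B1 pos kp by (intro mult_right_mono) auto
    then have "s * \<kappa> * Y \<le> 16 * \<tau>" using fin2 True by (simp add: mult_ac)
    then show False using c1 D1 by (simp add: \<kappa>_def field_simps)
  next
    case False
    then have "H = 1 / (256 * s * B^2)" by (auto simp: H_def min_def split: if_splits)
    then have "H * (256 * s * B^2) = 1" using pos B1 by simp
    then have "\<kappa> = 256 * B * (B * s * \<kappa> * H)" by algebra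
    also have "\<dots> \<le> 256 * B * (16 * \<tau>)" using fin2 B1 by (intro mult_left_mono) auto
    finally have "\<kappa> \<le> 4096 * (B * \<tau>)" by simp
    then have "\<rho> \<le> 4096 * D * (B * \<tau>)" using D1 by (simp add: \<kappa>_def field_simps)
    also have "\<dots> \<le> 4096 * D * (\<mu> * \<tau>)" using B\<mu> pos by (intro mult_left_mono mult_right_mono) auto
    finally show False using c2 by (simp add: mult_ac)
  qed
qed

text \<open>There are at most \<open>2 * Z / L\<close> cells of length \<open>L\<close>, so those with at most \<open>2 * m\<close> points together hold at most
\<open>4 * Z / q\<close> points, half of the assumed number; the rest lies in cells with more than \<open>2 * m\<close> points.\<close>

lemma rich_cells:
  fixes P :: "nat set"
  assumes P: "P \<subseteq> {y..<y + Z}" and L: "L = m * q" "1 \<le> L" "L \<le> Z" and card: "real (card P) \<ge> 8 * real Z / real q"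
  obtains \<Omega> where "finite \<Omega>" "\<Omega> \<subseteq> {y..<y + Z}" 
    "\<And>x. x \<in> \<Omega> \<Longrightarrow> 2 * m < card {t. t < L \<and> x + t \<in> P}"
    "real (card \<Omega>) \<ge> 4 * real Z / (real q * real L)"
proof -
  have finP: "finite P" using P finite_subset by blast
  define R where "R = Suc (Z div L)"
  define cell where "cell r = P \<inter> {y + r * L..<y + r * L + L}" for r
  define Rich where "Rich = {r. r < R \<and> 2 * m < card (cell r)}"
  have cover: "P \<subseteq> (\<Union>r<R. cell r)"
  proof
    fix p assume p: "p \<in> P"
    define r where "r = (p - y) div L"
    have "y \<le> p" "p < y + Z" using P p by auto
    then have "p - y < Z" by simp
    have "r < R" unfolding r_def R_def using \<open>p - y < Z\<close> by (simp add: div_le_mono less_imp_le le_imp_less_Suc)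
    moreover have "r * L \<le> p - y" "p - y < r * L + L"
      unfolding r_def using L dividend_less_div_times[of L "p - y"] by (auto simp: add.commute)
    ultimately show "p \<in> (\<Union>r<R. cell r)" using p \<open>y \<le> p\<close> by (auto simp: cell_def intro!: bexI[of _ r])
  qed
  have cell_le: "card (cell r) \<le> L" for r
    using card_mono[of "{y + r * L..<y + r * L + L}" "cell r"] by (simp add: cell_def)
  have fR: "finite Rich" "Rich \<subseteq> {..<R}" by (auto simp: Rich_def)
  have "card P \<le> card (\<Union>r<R. cell r)" using cover finP by (intro card_mono) (auto simp: cell_def)
  also have "\<dots> \<le> (\<Sum>r<R. card (cell r))" by (rule card_UN_le) simp
  also have "\<dots> \<le> (\<Sum>r<R. 2 * m + (if r \<in> Rich then L else 0))"
    by (rule sum_mono) (use cell_le in \<open>auto simp: Rich_def not_less intro: trans_le_add2\<close>)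
  also have "\<dots> = R * (2 * m) + (\<Sum>r<R. if r \<in> Rich then L else 0)" by (simp add: sum.distrib)
  also have "(\<Sum>r<R. if r \<in> Rich then L else 0) = card Rich * L"
    using fR by (simp add: sum.If_cases Int_absorb1 Int_def) (metis (no_types, lifting) Collect_cong Collect_mem_eq lessThan_iff subset_iff)
  finally have "real (card P) \<le> real (R * (2 * m) + card Rich * L)" by (simp only: of_nat_le_iff)
  then have 1: "real (card P) \<le> real R * (2 * m) + card Rich * real L" by simp
  have "real R \<le> 2 * (real Z / real L)"
  proof -
    have "real (Z div L) \<le> real Z / real L" by (rule of_nat_div_le_of_nat)
    moreover have "1 \<le> real Z / real L" using L(2,3) by simp
    ultimately show ?thesis by (simp add: R_def)
  qed
  then have "real R * (2 * m) \<le> 2 * (real Z / real L) * (2 * m)" by (intro mult_right_mono) auto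
  also have "\<dots> = 4 * real Z / real q" using L by (auto simp: field_simps)
  finally have 2: "real R * (2 * m) \<le> 4 * real Z / real q" .
  have "8 * real Z / real q = 2 * (4 * real Z / real q)" by simp
  then have "4 * real Z / real q \<le> card Rich * real L" using 1 2 card by linarith
  then have big: "real (card Rich) \<ge> 4 * real Z / (real q * real L)" using L by (simp add: field_simps)
  define \<Omega> where "\<Omega> = (\<lambda>r. y + r * L) ` Rich"
  have inj: "inj_on (\<lambda>r. y + r * L) Rich" using L by (auto simp: inj_on_def)
  show ?thesis
  proof
    show "finite \<Omega>" using fR by (simp add: \<Omega>_def)
    have in_cell: "{t. t < L \<and> y + r * L + t \<in> P} = (\<lambda>p. p - (y + r * L)) ` cell r" for r
      by (auto simp: cell_def image_iff intro!: bexI[of _ "y + r * L + _"])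
    have inj2: "inj_on (\<lambda>p. p - (y + r * L)) (cell r)" for r
      by (auto simp: inj_on_def cell_def)
    show "2 * m < card {t. t < L \<and> x + t \<in> P}" if "x \<in> \<Omega>" for x
      using that by (auto simp: \<Omega>_def Rich_def in_cell card_image[OF inj2])
    show "\<Omega> \<subseteq> {y..<y + Z}"
    proof
      fix x assume "x \<in> \<Omega>"
      then obtain r where r: "x = y + r * L" "2 * m < card (cell r)" by (auto simp: \<Omega>_def Rich_def)
      then have "cell r \<noteq> {}" by auto
      then obtain p where "p \<in> P" "p \<ge> x" using r by (auto simp: cell_def)
      then show "x \<in> {y..<y + Z}" using P r by auto
    qed
    show "real (card \<Omega>) \<ge> 4 * real Z / (real q * real L)" using big by (simp add: \<Omega>_def card_image[OF inj])
  qed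
qed

section \<open>Applying a relation to integers near a reciprocal\<close>

lemma inverse_shift_expansion:
  fixes x t :: real assumes "x > 0" "t \<ge> 0"
  shows "1 / (x + t) = (\<Sum>j<r. (-1) ^ j * t ^ j / x ^ Suc j) + (-1) ^ r * t ^ r / (x ^ r * (x + t))"
proof (induction r)
  case (Suc r)
  have split: "u / (v * (x + t)) = u / (x * v) + - t * u / (x * v * (x + t))" if "v > 0" for u v
  proof -
    have "x + t \<noteq> 0" "x \<noteq> 0" "v \<noteq> 0" using assms that by auto
    then show ?thesis by (simp add: divide_simps) (simp add: algebra_simps)
  qed
  have "(-1) ^ r * t ^ r / (x ^ r * (x + t)) = (-1) ^ r * t ^ r / x ^ Suc r + (-1) ^ Suc r * t ^ Suc r / (x ^ Suc r * (x + t))"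
    using split[of "x ^ r" "(-1) ^ r * t ^ r"] assms by (simp add: mult_ac)
  then show ?case using Suc.IH by simp
qed (use assms in simp)

text \<open>The geometric expansion of \<open>1 / (x + t)\<close>, summed against a relation of order \<open>i\<close>: the terms below \<open>i\<close> disappear.\<close>

lemma relation_sum_expansion:
  fixes c :: "nat \<Rightarrow> int" and x l :: real
  assumes "finite T" "x > 0" "0 \<le> l" "\<And>t. t \<in> T \<Longrightarrow> real t \<le> l" "(\<Sum>t\<in>T. \<bar>real_of_int (c t)\<bar>) \<le> W"
    and "\<And>j. j < i \<Longrightarrow> moment T c 0 j = 0" "i \<le> r"
  shows "\<bar>(\<Sum>t\<in>T. c t / (x + real t)) - (\<Sum>j=i..<r. (-1) ^ j * moment T c 0 j / x ^ Suc j)\<bar> \<le> W * l ^ r / x ^ Suc r"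
proof -
  have "(\<Sum>t\<in>T. c t / (x + real t)) =
     (\<Sum>t\<in>T. (\<Sum>j<r. c t * ((-1) ^ j * real t ^ j / x ^ Suc j)) + c t * ((-1) ^ r * real t ^ r / (x ^ r * (x + real t))))"
  proof (rule sum.cong)
    fix t assume "t \<in> T"
    have "c t / (x + real t) = c t * (1 / (x + real t))" by simp
    also have "\<dots> = (\<Sum>j<r. c t * ((-1) ^ j * real t ^ j / x ^ Suc j)) + c t * ((-1) ^ r * real t ^ r / (x ^ r * (x + real t)))"
      by (subst inverse_shift_expansion[of x "real t" r]) (use assms in \<open>simp_all add: distrib_left sum_distrib_left\<close>)
    finally show "c t / (x + real t) = (\<Sum>j<r. c t * ((-1) ^ j * real t ^ j / x ^ Suc j)) + c t * ((-1) ^ r * real t ^ r / (x ^ r * (x + real t)))" .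
  qed simp
  also have "\<dots> = (\<Sum>j<r. \<Sum>t\<in>T. c t * ((-1) ^ j * real t ^ j / x ^ Suc j)) + (\<Sum>t\<in>T. c t * ((-1) ^ r * real t ^ r / (x ^ r * (x + real t))))"
    unfolding sum.distrib by (subst sum.swap) simp
  also have "(\<Sum>j<r. \<Sum>t\<in>T. c t * ((-1) ^ j * real t ^ j / x ^ Suc j)) = (\<Sum>j<r. (-1) ^ j * moment T c 0 j / x ^ Suc j)"
    by (intro sum.cong) (auto simp: moment_def sum_distrib_left sum_divide_distrib mult_ac)
  also have "\<dots> = (\<Sum>j=i..<r. (-1) ^ j * moment T c 0 j / x ^ Suc j)"
    by (rule sum.mono_neutral_right) (use assms in auto)
  finally have "(\<Sum>t\<in>T. c t / (x + real t)) - (\<Sum>j=i..<r. (-1) ^ j * moment T c 0 j / x ^ Suc j)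
      = (\<Sum>t\<in>T. c t * ((-1) ^ r * real t ^ r / (x ^ r * (x + real t))))" by simp
  also have "\<bar>\<dots>\<bar> \<le> (\<Sum>t\<in>T. \<bar>c t * ((-1) ^ r * real t ^ r / (x ^ r * (x + real t)))\<bar>)" by (rule sum_abs)
  also have "\<dots> \<le> (\<Sum>t\<in>T. \<bar>real_of_int (c t)\<bar> * (l ^ r / x ^ Suc r))"
  proof (rule sum_mono)
    fix t assume t: "t \<in> T"
    have "real t ^ r / (x ^ r * (x + real t)) \<le> l ^ r / x ^ Suc r"
      using assms(2) assms(4)[OF t] by (intro frac_le power_mono) auto
    then show "\<bar>c t * ((-1) ^ r * real t ^ r / (x ^ r * (x + real t)))\<bar> \<le> \<bar>real_of_int (c t)\<bar> * (l ^ r / x ^ Suc r)"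
      using assms(2) unfolding abs_mult by (intro mult_left_mono) (simp_all add: abs_mult)
  qed
  also have "\<dots> = (\<Sum>t\<in>T. \<bar>real_of_int (c t)\<bar>) * (l ^ r / x ^ Suc r)" by (rule sum_distrib_right[symmetric])
  also have "\<dots> \<le> W * (l ^ r / x ^ Suc r)"
    using assms by (intro mult_right_mono) auto
  finally show ?thesis by simp
qed

text \<open>Up to sign, the \<open>i\<close>-th derivative of \<open>n / x\<close>.\<close>

definition scale :: "real \<Rightarrow> nat \<Rightarrow> real \<Rightarrow> real" where
  "scale n i x = n * fact i / x ^ Suc i"

lemma scale_Suc: "scale n (Suc i) x = scale n i x * real (Suc i) / x"
  by (simp add: scale_def mult_ac)

lemma scale_mono: "0 < k \<Longrightarrow> k \<le> x \<Longrightarrow> 0 \<le> n \<Longrightarrow> scale n i x \<le> scale n i k"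
  unfolding scale_def by (intro divide_left_mono power_mono) auto

text \<open>The integer \<open>A\<close> is the relation applied to the \<open>a (x + t)\<close>, up to sign. The first error term comes from
replacing \<open>a (x + t)\<close> by \<open>n / (x + t)\<close>, the second from truncating the expansion. The sharper estimate also keeps the
second term of the expansion; its coefficient \<open>N + i * M / 2\<close> is a half-integer, which is what makes it possible to
absorb it into an integer later.\<close>

lemma window_relation:
  fixes a :: "nat \<Rightarrow> int" and n s k :: real
  assumes rich: "2 * m < card {t. t < m * q \<and> x + t \<in> P}" and i: "i \<le> m" and q: "1 \<le> q"
    and k: "1 \<le> k" "k \<le> real x" and n: "0 \<le> n" and s: "0 \<le> s"
    and near: "\<And>p. p \<in> P \<Longrightarrow> \<bar>real_of_int (a p) * real p - n\<bar> \<le> s"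
  obtains A M N :: int where "1 \<le> M" "M \<le> weight m q * growth m q"
    "\<bar>A - M * scale n i x\<bar> \<le> (weight m q * s + weight m q * growth m q * real (m * q) * scale n i k) / k"
    "i < m \<Longrightarrow> \<bar>real_of_int N\<bar> \<le> weight m q * growth m q"
    "i < m \<Longrightarrow> \<bar>A - (M * scale n i x - (real_of_int N + real i * real_of_int M / 2) * scale n (Suc i) x)\<bar>
        \<le> (weight m q * s + weight m q * growth m q * real (m * q) * scale n (Suc i) k) / k"
proof -
  define W where "W = weight m q"
  define l where "l = real m * real q"
  have "2 * i + 1 \<le> card {t. t < m * q \<and> x + t \<in> P}" using rich i by linarith
  then obtain T where T: "T \<subseteq> {t. t < m * q \<and> x + t \<in> P}" "card T = 2 * i + 1" "finite T"
    by (rule obtain_subset_with_card_n)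
  have Tl: "T \<subseteq> {..m * q}" "\<And>t. t \<in> T \<Longrightarrow> real t \<le> l"
  proof -
    show "T \<subseteq> {..m * q}" using T by auto
    show "real t \<le> l" if "t \<in> T" for t
    proof -
      have "t \<le> m * q" using T that by auto
      then show ?thesis unfolding l_def by (metis of_nat_le_iff of_nat_mult)
    qed
  qed
  obtain c :: "nat \<Rightarrow> int" where c: "\<And>j. j < i \<Longrightarrow> moment T c 0 j = 0" "moment T c i 0 > 0"
    "(\<Sum>t\<in>T. \<bar>real_of_int (c t)\<bar>) \<le> W"
    unfolding W_def using exact_order_relation[OF Tl(1) T(2) i q] by blast
  have W1: "1 \<le> W" unfolding W_def by (rule weight_ge_1[OF q])
  have van: "moment T c j 0 = 0" if "j < i" for j by (rule moment_eq_0'[OF c(1)]) (use that in auto)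
  define M where "M = moment T c i 0"
  define N where "N = moment T c (Suc i) 0"
  define A where "A = (-1) ^ i * (\<Sum>t\<in>T. c t * a (x + t))"
  have mom: "\<bar>real_of_int (moment T c j 0)\<bar> \<le> W * growth m q" if "j \<le> m" for j
  proof -
    have "\<bar>real_of_int (moment T c j 0)\<bar> \<le> (\<Sum>t\<in>T. \<bar>real_of_int (c t)\<bar> * real (t choose j))"
      unfolding moment_def by (simp add: sum_abs[THEN order.trans] abs_mult order.trans[OF sum_abs])
    also have "\<dots> \<le> (\<Sum>t\<in>T. \<bar>real_of_int (c t)\<bar> * growth m q)"
    proof (intro sum_mono mult_left_mono)
      fix t assume "t \<in> T"
      then have "real (t choose j) \<le> exp (real m) * real q ^ j" using Tl that by (intro choose_le_growth) auto
      also have "\<dots> \<le> growth m q" by (rule power_le_growth_top[OF that q])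
      finally show "real (t choose j) \<le> growth m q" .
    qed auto
    also have "\<dots> = (\<Sum>t\<in>T. \<bar>real_of_int (c t)\<bar>) * growth m q" by (simp add: sum_distrib_right)
    also have "\<dots> \<le> W * growth m q" using c(3) growth_ge_1[OF q, of m] by (intro mult_right_mono) auto
    finally show ?thesis .
  qed
  have l_pow: "l ^ j \<le> fact j * growth m q" if "j \<le> m" for j
  proof -
    have "l ^ j \<le> fact j * (exp (real m) * real q ^ j)"
      using power_le_growth[of j m "m * q" q] that by (simp add: l_def)
    also have "\<dots> \<le> fact j * growth m q" using power_le_growth_top[OF that q] by (intro mult_left_mono) auto
    finally show ?thesis .
  qed
  have approx: "\<bar>A - (-1) ^ i * n * (\<Sum>t\<in>T. c t / (real x + real t))\<bar> \<le> W * s / k"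
  proof -
    have "A - (-1) ^ i * n * (\<Sum>t\<in>T. c t / (real x + real t)) = (-1) ^ i * (\<Sum>t\<in>T. c t * (a (x + t) - n / (real x + real t)))"
      by (simp add: A_def sum_subtractf right_diff_distrib sum_distrib_left mult_ac)
    then have "\<bar>A - (-1) ^ i * n * (\<Sum>t\<in>T. c t / (real x + real t))\<bar> = \<bar>\<Sum>t\<in>T. c t * (a (x + t) - n / (real x + real t))\<bar>"
      by (simp add: abs_mult power_abs)
    also have "\<dots> \<le> (\<Sum>t\<in>T. \<bar>real_of_int (c t)\<bar> * (s / k))"
    proof (rule order.trans[OF sum_abs], rule sum_mono)
      fix t assume t: "t \<in> T"
      have pos: "real x + real t > 0" using k by linarith
      have "\<bar>real_of_int (a (x + t)) * real (x + t) - n\<bar> \<le> s" using near[of "x + t"] T t by blast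
      moreover have "a (x + t) - n / (real x + real t) = (real_of_int (a (x + t)) * real (x + t) - n) / (real x + real t)"
        using pos by (simp add: field_simps)
      ultimately have "\<bar>a (x + t) - n / (real x + real t)\<bar> \<le> s / (real x + real t)"
        using pos by (simp add: divide_right_mono)
      also have "\<dots> \<le> s / k" using s k by (intro divide_left_mono) auto
      finally show "\<bar>c t * (a (x + t) - n / (real x + real t))\<bar> \<le> \<bar>real_of_int (c t)\<bar> * (s / k)"
        unfolding abs_mult by (intro mult_left_mono) auto
    qed
    also have "\<dots> = (\<Sum>t\<in>T. \<bar>real_of_int (c t)\<bar>) * (s / k)" by (rule sum_distrib_right[symmetric])
    also have "\<dots> \<le> W * (s / k)" using c(3) s k by (intro mult_right_mono) auto
    finally show ?thesis by simp
  qed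
  have expand: "\<bar>A - (-1) ^ i * n * (\<Sum>j=i..<Suc r. (-1) ^ j * moment T c 0 j / real x ^ Suc j)\<bar>
      \<le> (W * s + W * growth m q * real (m * q) * scale n r k) / k" if r: "i \<le> r" "r \<le> m" for r
  proof -
    define S1 where "S1 = (\<Sum>t\<in>T. c t / (real x + real t))"
    define S2 where "S2 = (\<Sum>j=i..<Suc r. (-1) ^ j * moment T c 0 j / real x ^ Suc j)"
    have "\<bar>S1 - S2\<bar> \<le> W * l ^ Suc r / real x ^ Suc (Suc r)"
      unfolding S1_def S2_def by (rule relation_sum_expansion) (use T Tl c k r in \<open>auto simp: l_def\<close>)
    then have "n * \<bar>S1 - S2\<bar> \<le> n * (W * l ^ Suc r / real x ^ Suc (Suc r))" using n by (rule mult_left_mono)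
    also have "\<dots> \<le> n * (W * (l * (fact r * growth m q)) / k ^ Suc (Suc r))"
      using n W1 k l_pow[OF r(2)] growth_ge_1[OF q, of m]
      by (intro mult_left_mono frac_le power_mono) (auto simp: l_def intro!: mult_left_mono mult_nonneg_nonneg)
    also have "\<dots> = W * growth m q * real (m * q) * scale n r k / k"
      by (simp add: scale_def l_def mult_ac)
    finally have "\<bar>(-1) ^ i * n * S1 - (-1) ^ i * n * S2\<bar> \<le> W * growth m q * real (m * q) * scale n r k / k"
      using n by (simp add: abs_mult power_abs flip: right_diff_distrib)
    with approx have "\<bar>A - (-1) ^ i * n * S2\<bar> \<le> W * s / k + W * growth m q * real (m * q) * scale n r k / k"
      unfolding S1_def by linarith
    then show ?thesis unfolding S2_def by (simp add: add_divide_distrib)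
  qed
  have lead: "moment T c 0 i = fact i * M"
  proof -
    have "fact 0 * moment T c 0 i = fact i * moment T c i 0" by (rule moment_lead[OF van]) auto
    then show ?thesis by (simp add: M_def)
  qed
  have sgn: "(-1) ^ i * (-1) ^ i = (1::real)" by (simp flip: power_mult_distrib)
  have b1: "1 \<le> M" using c(2) by (simp add: M_def)
  have b2: "M \<le> weight m q * growth m q" using mom[OF i] by (simp add: M_def W_def)
  have b3: "\<bar>A - M * scale n i x\<bar> \<le> (weight m q * s + weight m q * growth m q * real (m * q) * scale n i k) / k"
  proof -
    have "(-1) ^ i * n * (\<Sum>j=i..<Suc i. (-1) ^ j * moment T c 0 j / real x ^ Suc j) = ((-1) ^ i * (-1) ^ i) * (M * scale n i x)"
      by (simp add: lead scale_def mult_ac)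
    then show ?thesis using expand[of i] i unfolding sgn by (simp add: W_def)
  qed
  have b4: "\<bar>real_of_int N\<bar> \<le> weight m q * growth m q" if "i < m"
    using mom[of "Suc i"] that by (simp add: N_def W_def)
  have b5: "\<bar>A - (M * scale n i x - (real_of_int N + real i * real_of_int M / 2) * scale n (Suc i) x)\<bar>
        \<le> (weight m q * s + weight m q * growth m q * real (m * q) * scale n (Suc i) k) / k" if im: "i < m"
  proof -
    have "2 * fact 0 * moment T c 0 (Suc i - 0) =
        2 * fact (Suc i) * moment T c (Suc i) 0 + fact i * moment T c i 0 * (int i * (int i + 1) - int 0 * (int 0 - 1))"
      by (rule moment_second[OF van]) auto
    then have "real_of_int (2 * moment T c 0 (Suc i)) = real_of_int (2 * fact (Suc i) * N + fact i * M * (int i * (int i + 1)))"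
      unfolding M_def N_def by (simp only: fact_0 diff_zero of_nat_0 mult_zero_left mult_1_right)
    also have "\<dots> = 2 * (fact (Suc i) * (real_of_int N + real i * real_of_int M / 2))"
      by (simp add: algebra_simps)
    finally have sec: "real_of_int (moment T c 0 (Suc i)) = fact (Suc i) * (real_of_int N + real i * real_of_int M / 2)"
      by simp
    define u where "u = fact i * M / real x ^ Suc i"
    define v where "v = fact (Suc i) * (real_of_int N + real i * real_of_int M / 2) / real x ^ Suc (Suc i)"
    have "(\<Sum>j=i..<Suc (Suc i). (-1) ^ j * moment T c 0 j / real x ^ Suc j) =
         (-1) ^ i * moment T c 0 i / real x ^ Suc i + (-1) ^ Suc i * moment T c 0 (Suc i) / real x ^ Suc (Suc i)"
      by (simp del: power_Suc)
    also have "\<dots> = (-1) ^ i * (u - v)"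
      unfolding u_def v_def by (simp add: sec lead right_diff_distrib del: fact_Suc)
    finally have eq: "(\<Sum>j=i..<Suc (Suc i). (-1) ^ j * moment T c 0 j / real x ^ Suc j) = (-1) ^ i * (u - v)" .
    have sq: "(-1) ^ i * n * ((-1) ^ i * (u - v)) = ((-1) ^ i * (-1) ^ i) * (n * u - n * v)" by algebra
    have nu: "n * u = M * scale n i x" "n * v = (real_of_int N + real i * real_of_int M / 2) * scale n (Suc i) x"
      by (simp_all only: u_def v_def scale_def times_divide_eq_right times_divide_eq_left of_int_mult of_int_fact mult_ac)
    have "\<bar>A - (-1) ^ i * n * (\<Sum>j=i..<Suc (Suc i). (-1) ^ j * moment T c 0 j / real x ^ Suc j)\<bar>
      \<le> (W * s + W * growth m q * real (m * q) * scale n (Suc i) k) / k"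
      by (rule expand) (use im in auto)
    then show ?thesis unfolding eq sq sgn nu W_def mult_1_left .
  qed
  show ?thesis by (rule that[OF b1 b2 b3 b4 b5])
qed

section \<open>Excluding every size of the numerator\<close>

text \<open>All sizes are measured in powers of \<open>g = k powr (1 / 100)\<close>, which turns the exponents into integers: \<open>Y\<close> lies between
\<open>g ^ 40\<close> and \<open>g ^ 60\<close>, relations have weight at most \<open>g ^ 8\<close> and leading moment at most \<open>g ^ 13\<close>. Logarithmic losses
(the number \<open>D\<close> of dyadic classes and the density \<open>\<rho>\<close> of the windows) together cost less than one factor \<open>g\<close>. The windows start at
points of \<open>\<Omega>\<^sub>1\<close>, close to \<open>k\<close>, and of \<open>\<Omega>\<^sub>3\<close>, beyond \<open>k + 19 / 10 * Y\<close>. Together with a bound for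
\<open>scale n m k\<close> and a point of \<open>P\<close> at either end of the interval, the assumptions are contradictory, as the last lemma of
the locale shows.\<close>

locale near_multiples =
  fixes k n m q D :: nat and g Y \<rho> :: real and P \<Omega>\<^sub>1 \<Omega>\<^sub>3 :: "nat set" and a :: "nat \<Rightarrow> int"
  assumes k: "real k = g ^ 100" and g: "100 \<le> g"
    and Y: "g ^ 40 \<le> Y" "Y \<le> g ^ 60"
    and q: "1 \<le> q" and m: "real m + 3 \<le> g"
    and W: "3 * weight m q \<le> g ^ 8"
    and WG: "weight m q * growth m q * real (m * q) \<le> g ^ 13" "weight m q * growth m q \<le> g ^ 13"
    and D: "g ^ 13 < 2 ^ D" and \<rho>: "0 < \<rho>" "\<rho> \<le> 1" "4096 * D \<le> \<rho> * g"
    and \<Omega>\<^sub>1: "finite \<Omega>\<^sub>1" "\<And>x. x \<in> \<Omega>\<^sub>1 \<Longrightarrow> real k \<le> real x \<and> real x \<le> k + Y" "\<rho> * (2 * Y) \<le> card \<Omega>\<^sub>1"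
    and \<Omega>\<^sub>3: "finite \<Omega>\<^sub>3" "\<And>x. x \<in> \<Omega>\<^sub>3 \<Longrightarrow> k + 19 / 10 * Y \<le> real x \<and> real x \<le> k + 3 * Y" "\<rho> * (2 * Y) \<le> card \<Omega>\<^sub>3"
    and rich: "\<And>x. x \<in> \<Omega>\<^sub>1 \<union> \<Omega>\<^sub>3 \<Longrightarrow> 2 * m < card {t. t < m * q \<and> x + t \<in> P}"
    and P: "\<And>p. p \<in> P \<Longrightarrow> k < p \<and> p < k + 3 * Y"
    and a: "\<And>p. p \<in> P \<Longrightarrow> 0 \<le> a p * int p - int n \<and> a p * int p - int n < int p - int k"
    and n: "2 * k < n"
begin

lemma g_power: "i \<le> j \<Longrightarrow> g ^ i \<le> g ^ j" "0 < g ^ i" "1 \<le> g ^ i"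
  using g by (auto intro: power_increasing one_le_power)

lemma Y_pos: "0 < Y" "g \<le> Y"
  using Y g_power[of 40] g_power(1)[of 1 40] by (auto intro: order.trans)

lemma k_pos: "0 < real k" "1 \<le> real k"
  using g_power(2)[of 100] g_power(3)[of 100] k by linarith+

lemma scale_nonneg: "0 \<le> x \<Longrightarrow> 0 \<le> scale n i x"
  by (simp add: scale_def)

lemma three_Y: "3 * Y * (m + 2) \<le> k / 2"
proof -
  have "3 * Y * (m + 2) \<le> 3 * g ^ 60 * g"
    using Y m Y_pos by (intro mult_mono) auto
  also have "\<dots> \<le> g ^ 100 / 2"
  proof -
    have "6 * g ^ 61 \<le> g ^ 1 * g ^ 61" using g by (intro mult_right_mono) auto
    also have "\<dots> \<le> g ^ 100" unfolding power_add[symmetric] by (rule g_power) simp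
    finally show ?thesis by (simp add: eval_nat_numeral)
  qed
  finally show ?thesis using k by simp
qed

text \<open>Over the whole interval each \<open>scale n j\<close> changes by at most a factor \<open>2\<close>, by Bernoulli's inequality.\<close>

lemma scale_bounds:
  assumes "j \<le> m + 1" "real k \<le> x" "x \<le> k + 3 * Y"
  shows "scale n j k / 2 \<le> scale n j x" "scale n j x \<le> scale n j k"
proof -
  show "scale n j x \<le> scale n j k" using assms k_pos by (intro scale_mono) auto
  have x: "0 < x" using assms k_pos by linarith
  define u where "u = 3 * Y / k"
  have u: "real (m + 2) * u \<le> 1 / 2" "0 \<le> u"
    using three_Y k_pos Y_pos by (auto simp: u_def field_simps)
  have u1: "u \<le> 1" using u mult_right_mono[of 1 "real (m + 2)" u] by simp
  have "1 / 2 \<le> 1 - real (Suc j) * u"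
    using u assms mult_right_mono[of "real (Suc j)" "real (m + 2)" u] by simp
  also have "\<dots> \<le> (1 - u) ^ Suc j"
    using Bernoulli_inequality[of "- u" "Suc j"] u1 by simp
  also have "\<dots> \<le> (k / x) ^ Suc j"
  proof (rule power_mono)
    have "(1 - u) * x \<le> (1 - u) * (k + 3 * Y)" using assms u1 by (intro mult_left_mono) auto
    also have "\<dots> = k - u * (3 * Y)" using k_pos by (simp add: u_def field_simps)
    also have "\<dots> \<le> k" using u Y_pos by simp
    finally show "1 - u \<le> k / x" using x by (simp add: field_simps)
  qed (use u1 in auto)
  finally have "scale n j k * (1 / 2) \<le> scale n j k * (k / x) ^ Suc j"
    by (intro mult_left_mono scale_nonneg) auto
  also have "\<dots> = scale n j x" using k_pos x by (simp add: scale_def power_divide del: power_Suc)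
  finally show "scale n j k / 2 \<le> scale n j x" by simp
qed

lemma scale_deriv:
  assumes "0 < x" shows "(scale n j has_real_derivative - scale n (Suc j) x) (at x)"
proof -
  have "((\<lambda>x. n * fact j / x ^ Suc j) has_real_derivative - (n * fact j) * (real (Suc j) * x ^ j) / (x ^ Suc j * x ^ Suc j)) (at x)"
    by (rule derivative_eq_intros refl | use assms in simp)+
  moreover have "- (n * fact j) * (real (Suc j) * x ^ j) / (x ^ Suc j * x ^ Suc j) = - scale n (Suc j) x"
    using assms by (simp add: scale_def field_simps)
  ultimately show ?thesis unfolding scale_def[abs_def] by simp
qed

lemma scale_diff:
  assumes "j \<le> m" "real k \<le> x" "x < x'" "x' \<le> k + 3 * Y"
  shows "scale n (Suc j) k / 2 * (x' - x) \<le> scale n j x - scale n j x'"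
    "scale n j x - scale n j x' \<le> scale n (Suc j) k * (x' - x)"
proof -
  have "\<exists>z>x. z < x' \<and> scale n j x' - scale n j x = (x' - x) * (- scale n (Suc j) z)"
    by (rule MVT2[OF \<open>x < x'\<close>]) (use assms k_pos in \<open>auto intro!: scale_deriv\<close>)
  then obtain z where z: "x < z" "z < x'" "scale n j x' - scale n j x = (x' - x) * (- scale n (Suc j) z)" by blast
  then have eq: "scale n j x - scale n j x' = scale n (Suc j) z * (x' - x)" by (simp add: algebra_simps)
  show "scale n (Suc j) k / 2 * (x' - x) \<le> scale n j x - scale n j x'"
    "scale n j x - scale n j x' \<le> scale n (Suc j) k * (x' - x)"
    unfolding eq using assms z scale_bounds[of "Suc j" z] by (auto intro!: mult_right_mono)
qed

text \<open>The integer relation of a window, with the bounds expressed in powers of \<open>g\<close>.\<close>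

lemma window:
  assumes x: "x \<in> \<Omega>\<^sub>1 \<union> \<Omega>\<^sub>3" and i: "i \<le> m"
  obtains A M N :: int where "1 \<le> M" "M \<le> g ^ 13"
    "\<bar>A - M * scale n i x\<bar> \<le> (g ^ 8 * Y + g ^ 13 * scale n i k) / k"
    "i < m \<Longrightarrow> \<bar>real_of_int N\<bar> \<le> g ^ 13"
    "i < m \<Longrightarrow> \<bar>A - (M * scale n i x - (real_of_int N + real i * real_of_int M / 2) * scale n (Suc i) x)\<bar>
        \<le> (g ^ 8 * Y + g ^ 13 * scale n (Suc i) k) / k"
proof -
  have near: "\<bar>real_of_int (a p) * real p - real n\<bar> \<le> 3 * Y" if p: "p \<in> P" for p
  proof -
    have "real_of_int 0 \<le> real_of_int (a p * int p - int n)" "real_of_int (a p * int p - int n) < real_of_int (int p - int k)"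
      using a[OF p] by (simp_all only: of_int_le_iff of_int_less_iff)
    then show ?thesis using P[OF p] by auto
  qed
  have three_Y0: "0 \<le> 3 * Y" using Y_pos by simp
  have xk: "real k \<le> x" using x \<Omega>\<^sub>1(2)[of x] \<Omega>\<^sub>3(2)[of x] Y_pos by auto
  have err: "(weight m q * (3 * Y) + weight m q * growth m q * real (m * q) * scale n j k) / k
      \<le> (g ^ 8 * Y + g ^ 13 * scale n j k) / k" for j
  proof (intro divide_right_mono add_mono)
    show "weight m q * (3 * Y) \<le> g ^ 8 * Y" using mult_right_mono[OF W, of Y] Y_pos by simp
    show "weight m q * growth m q * real (m * q) * scale n j k \<le> g ^ 13 * scale n j k"
      using WG by (intro mult_right_mono scale_nonneg) auto
  qed auto
  obtain A M N :: int where *: "1 \<le> M" "M \<le> weight m q * growth m q"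
    "\<bar>A - M * scale n i x\<bar> \<le> (weight m q * (3 * Y) + weight m q * growth m q * real (m * q) * scale n i k) / k"
    "i < m \<Longrightarrow> \<bar>real_of_int N\<bar> \<le> weight m q * growth m q"
    "i < m \<Longrightarrow> \<bar>A - (M * scale n i x - (real_of_int N + real i * real_of_int M / 2) * scale n (Suc i) x)\<bar>
        \<le> (weight m q * (3 * Y) + weight m q * growth m q * real (m * q) * scale n (Suc i) k) / k"
    using window_relation[OF rich[OF x] i q k_pos(2) xk of_nat_0_le_iff three_Y0 near] by blast
  show ?thesis
    by (rule that[of M A N]) (use * err[of i] err[of "Suc i"] WG(2) in \<open>auto intro: order.trans\<close>)
qed

lemma windows_nonempty: "\<Omega>\<^sub>1 \<noteq> {}" "\<Omega>\<^sub>3 \<noteq> {}"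
  using \<Omega>\<^sub>1(3) \<Omega>\<^sub>3(3) mult_pos_pos[OF \<rho>(1), of "2 * Y"] Y_pos by auto

lemma few_classes: "4 * D \<le> \<rho> * (2 * Y)"
proof -
  have "4096 * D \<le> \<rho> * Y" using \<rho> Y_pos by (smt (verit) mult_left_mono)
  moreover have "\<rho> * (2 * Y) = 2 * (\<rho> * Y)" by simp
  ultimately show ?thesis by linarith
qed

text \<open>Here \<open>M * scale n i x\<close> is at most \<open>g ^ 13 / g ^ 14\<close>, so the integer next to it is \<open>0\<close>; but the error is at most
\<open>2 / g ^ 32\<close>, less than \<open>scale n i x\<close>, which is at least \<open>1 / (2 * g ^ 30)\<close>.\<close>

lemma no_tiny_scale:
  assumes "i \<le> m" "1 \<le> scale n i k * g ^ 30" "scale n i k * g ^ 14 \<le> 1"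
  shows False
proof -
  define \<nu> where "\<nu> = scale n i k"
  obtain x where x: "x \<in> \<Omega>\<^sub>1" using windows_nonempty by blast
  obtain A M :: int where w: "1 \<le> M" "M \<le> g ^ 13" "\<bar>real_of_int A - M * scale n i x\<bar> \<le> (g ^ 8 * Y + g ^ 13 * \<nu>) / k"
    unfolding \<nu>_def by (rule window[of x i]) (use x assms in auto)
  have \<sigma>: "\<nu> / 2 \<le> scale n i x" "scale n i x \<le> \<nu>" "0 \<le> \<nu>"
    using scale_bounds[of i x] \<Omega>\<^sub>1(2)[OF x] assms Y_pos scale_nonneg[of k i] by (auto simp: \<nu>_def)
  have gl: "g * (g ^ 13 * \<nu>) \<le> 1" using assms(3) unfolding \<nu>_def by (simp add: eval_nat_numeral mult_ac)
  have "g ^ 8 * Y \<le> g ^ 8 * g ^ 60" using Y g g_power by (intro mult_left_mono) auto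
  also have "\<dots> = g ^ 68" by (simp flip: power_add)
  finally have g8: "g ^ 8 * Y \<le> g ^ 68" .
  have "0 \<le> g ^ 13 * \<nu>" using \<sigma> g by simp
  then have gl': "100 * (g ^ 13 * \<nu>) \<le> 1" using gl mult_right_mono[OF g, of "g ^ 13 * \<nu>"] by linarith
  have "g ^ 8 * Y + g ^ 13 * \<nu> \<le> 2 * g ^ 68" using g8 gl' g_power(3)[of 68] by linarith
  then have err: "(g ^ 8 * Y + g ^ 13 * \<nu>) / k \<le> 2 * g ^ 68 / g ^ 100" unfolding k using g g_power by (intro divide_right_mono) auto
  have e2: "2 * g ^ 68 / g ^ 100 = 2 / g ^ 32" using g by (simp add: field_simps flip: power_add)
  have "g ^ 1 \<le> g ^ 32" by (rule g_power) simp
  then have small: "2 / g ^ 32 \<le> 1 / 2" using g by (simp add: field_simps)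
  have "M * scale n i x \<le> g ^ 13 * \<nu>" using w \<sigma> g g_power by (intro mult_mono) auto
  moreover have "1 * (\<nu> / 2) \<le> M * scale n i x" using w \<sigma> by (intro mult_mono) auto
  ultimately have M\<sigma>: "\<nu> / 2 \<le> M * scale n i x" "M * scale n i x \<le> 1 / 100" using gl' by auto
  have "\<bar>real_of_int A\<bar> < 1" using w(3) err e2 small M\<sigma> \<sigma> by linarith
  then have "A = 0" by linarith
  then have "\<nu> / 2 \<le> 2 / g ^ 32" using w(3) err e2 M\<sigma> by simp
  then have "\<nu> * g ^ 32 \<le> 4" using g by (simp add: field_simps)
  moreover have "g ^ 2 * 1 \<le> g ^ 2 * (\<nu> * g ^ 30)" using assms by (intro mult_left_mono) (auto simp: \<nu>_def)
  moreover have "g ^ 2 * (\<nu> * g ^ 30) = \<nu> * g ^ 32" by (simp flip: power_add)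
  moreover have "100 * 100 \<le> g ^ 2" using mult_mono[OF g g] g by (simp add: power2_eq_square)
  ultimately show False by linarith
qed

text \<open>The slope of \<open>scale n i\<close> is about \<open>(i + 1) * scale n i k / k\<close> in size, where \<open>i + 1 \<le> g\<close>. The lower bound \<open>g ^ 10\<close> makes the variation over the interval exceed the
error \<open>g ^ 8 * Y / k\<close>; the upper bound \<open>g ^ 70\<close> keeps the change over one unit step below \<open>1 / g ^ 26\<close>, the
separation of fractions with denominators up to \<open>g ^ 13\<close>.\<close>

lemma no_large_scale:
  assumes i: "i \<le> m" and \<nu>: "g ^ 10 \<le> scale n i k" "scale n i k \<le> g ^ 70"
  shows False
proof -
  define \<nu> where "\<nu> = scale n i k"
  define \<tau> where "\<tau> = (g ^ 8 * Y + g ^ 13 * \<nu>) / k"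
  define s where "s = scale n (Suc i) k / 2"
  have "\<exists>A M. 1 \<le> M \<and> real_of_int M \<le> g ^ 13 \<and> \<bar>real_of_int A - M * scale n i x\<bar> \<le> \<tau>" if "x \<in> \<Omega>\<^sub>1" for x
    unfolding \<tau>_def \<nu>_def by (rule window[of x i]) (use that i in auto)
  then obtain A M where w: "\<And>x. x \<in> \<Omega>\<^sub>1 \<Longrightarrow> 1 \<le> M x \<and> real_of_int (M x) \<le> g ^ 13 \<and> \<bar>real_of_int (A x) - M x * scale n i x\<bar> \<le> \<tau>"
    by metis
  have l: "g ^ 10 \<le> \<nu>" "\<nu> \<le> g ^ 70" "0 < \<nu>"
    using \<nu> g_power(2)[of 10] unfolding \<nu>_def by linarith+
  have s_eq: "s = \<nu> * (i + 1) / (2 * g ^ 100)" unfolding s_def scale_Suc \<nu>_def k by simp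
  have i1: "1 \<le> real (i + 1)" "real (i + 1) \<le> g" using i m by auto
  have \<tau>0: "0 < \<tau>" unfolding \<tau>_def using l g Y_pos g_power k_pos by (intro divide_pos_pos add_pos_pos mult_pos_pos) auto
  have D': "16 * real D \<le> \<rho> * g / 256" "1024 * real D \<le> \<rho> * g / 4" using \<rho> by auto
  show False
  proof (rule two_window_contradiction[of \<Omega>\<^sub>1 "2 * Y" \<rho> M "g ^ 13" D A "\<lambda>x. scale n i x" \<tau> s])
    show "real x - real x' \<le> 2 * Y" if "x \<in> \<Omega>\<^sub>1" "x' \<in> \<Omega>\<^sub>1" for x x'
      using \<Omega>\<^sub>1(2)[OF that(1)] \<Omega>\<^sub>1(2)[OF that(2)] Y_pos by linarith
    show "s * (real x' - real x) \<le> \<bar>scale n i x' - scale n i x\<bar> \<and> \<bar>scale n i x' - scale n i x\<bar> \<le> 16 * s * (real x' - real x)"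
      if x: "x \<in> \<Omega>\<^sub>1" "x' \<in> \<Omega>\<^sub>1" "x < x'" for x x'
    proof -
      have "s * (real x' - real x) \<le> scale n i x - scale n i x'" "scale n i x - scale n i x' \<le> 2 * s * (real x' - real x)"
        using scale_diff[OF i, of x x'] x \<Omega>\<^sub>1(2)[OF x(1)] \<Omega>\<^sub>1(2)[OF x(2)] Y_pos by (auto simp: s_def)
      moreover have "0 \<le> s * (real x' - real x)" using x by (simp add: s_def scale_nonneg)
      ultimately show ?thesis by simp
    qed
    show "0 < s" unfolding s_eq using l g by simp
    show "16 * D * \<tau> < s * \<rho> * (2 * Y)"
    proof -
      have "16 * D * (g ^ 8 * Y + g ^ 13 * \<nu>) \<le> \<rho> * g / 256 * (g ^ 8 * Y + g ^ 13 * \<nu>)"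
        using D' l g Y_pos g g_power by (intro mult_right_mono) auto
      also have "\<dots> = \<rho> / 256 * (g ^ 9 * Y + g ^ 14 * \<nu>)" by (simp add: algebra_simps eval_nat_numeral)
      also have "\<dots> \<le> \<rho> / 256 * (\<nu> * Y + Y * \<nu>)"
      proof (intro mult_left_mono add_mono mult_right_mono)
        show "g ^ 9 \<le> \<nu>" "g ^ 14 \<le> Y" using l Y g_power(1)[of 9 10] g_power(1)[of 14 40] by auto
      qed (use \<rho> l Y_pos in auto)
      also have "\<dots> < \<nu> * \<rho> * Y * 1" using \<rho> l Y_pos by simp
      also have "\<dots> \<le> \<nu> * \<rho> * Y * (i + 1)" using i1 \<rho> l Y_pos by (intro mult_left_mono) auto
      finally have "16 * D * (g ^ 8 * Y + g ^ 13 * \<nu>) / g ^ 100 < \<nu> * \<rho> * Y * (i + 1) / g ^ 100"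
        using g_power(2)[of 100] by (intro divide_strict_right_mono) auto
      moreover have "16 * D * \<tau> = 16 * D * (g ^ 8 * Y + g ^ 13 * \<nu>) / g ^ 100" by (simp add: \<tau>_def k)
      moreover have "s * \<rho> * (2 * Y) = \<nu> * \<rho> * Y * (i + 1) / g ^ 100" by (simp add: s_eq)
      ultimately show ?thesis by linarith
    qed
    show "4096 * D * g ^ 13 * \<tau> < \<rho>"
    proof -
      have "4096 * D * g ^ 13 * \<tau> \<le> \<rho> * g * g ^ 13 * \<tau>" using \<rho> \<tau>0 g g_power by (intro mult_right_mono) auto
      also have "\<dots> = \<rho> * (g ^ 22 * Y + g ^ 27 * \<nu>) / g ^ 100" unfolding \<tau>_def k by (simp add: algebra_simps eval_nat_numeral)
      also have "\<dots> \<le> \<rho> * (g ^ 22 * g ^ 60 + g ^ 27 * g ^ 70) / g ^ 100"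
        using Y l \<rho> g g_power by (intro divide_right_mono mult_left_mono add_mono) auto
      also have "\<dots> = \<rho> * ((g ^ 82 + g ^ 97) / g ^ 100)" by (simp flip: power_add)
      also have "\<dots> < \<rho> * 1"
      proof (rule mult_strict_left_mono)
        have "g ^ 82 \<le> g ^ 97" by (rule g_power) simp
        moreover have "2 * g ^ 97 < g ^ 3 * g ^ 97" using g g_power(1)[of 1 3] g_power(2)[of 97] by (intro mult_strict_right_mono) auto
        moreover have "g ^ 3 * g ^ 97 = g ^ 100" by (simp flip: power_add)
        ultimately show "(g ^ 82 + g ^ 97) / g ^ 100 < 1" using g_power(2)[of 100] by (simp add: field_simps)
      qed (use \<rho> in auto)
      finally show ?thesis by simp
    qed
    show "1024 * D * s * (g ^ 13)\<^sup>2 \<le> \<rho>"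
    proof -
      have "s \<le> g ^ 70 * g / (2 * g ^ 100)" unfolding s_eq using l i1 g by (intro divide_right_mono mult_mono) auto
      then have "1024 * D * s * (g ^ 13)\<^sup>2 \<le> \<rho> * g / 4 * (g ^ 70 * g / (2 * g ^ 100)) * (g ^ 13)\<^sup>2"
        using D' \<rho> g \<open>0 < s\<close> by (intro mult_right_mono mult_mono) auto
      also have "\<dots> = \<rho> * (g ^ 98 / (8 * g ^ 100))" by (simp add: eval_nat_numeral)
      also have "\<dots> \<le> \<rho> * 1"
      proof (rule mult_left_mono)
        have "g ^ 98 \<le> g ^ 100" by (rule g_power) simp
        then show "g ^ 98 / (8 * g ^ 100) \<le> 1" using g_power(2)[of 98] by (subst divide_le_eq_1_pos) linarith+
      qed (use \<rho> in auto)
      finally show ?thesis by simp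
    qed
  qed (use w \<Omega>\<^sub>1 \<rho> D Y_pos g_power \<tau>0 few_classes in auto)
qed

text \<open>For \<open>n\<close> only slightly larger than \<open>k\<close> the quotient \<open>n / p\<close> varies by at most \<open>1 / 4\<close> over the whole interval, so \<open>a\<close> is constant.
The hypothesis \<open>2 * k < n\<close> makes this constant at least \<open>2\<close>, which rules out a point of \<open>P\<close> beyond
\<open>k + 2 * Y\<close>.\<close>

lemma no_smallest_scale:
  assumes "scale n 0 k \<le> g ^ 10" and p1: "p1 \<in> P" "real p1 < k + Y" and p3: "p3 \<in> P" "real k + 2 * Y < p3"
  shows False
proof -
  have "a p1 * int p1 \<ge> int n" "a p3 * int p3 \<ge> int n" "a p3 * int p3 - int n < int p3 - int k"
    using a[OF p1(1)] a[OF p3(1)] by linarith+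
  then have r: "real_of_int (a p1 * int p1) \<ge> real_of_int (int n)" "real_of_int (a p3 * int p3) \<ge> real_of_int (int n)"
      "real_of_int (a p3 * int p3 - int n) < real_of_int (int p3 - int k)"
      "real_of_int (a p1 * int p1 - int n) < real_of_int (int p1 - int k)"
    using a p1 by (simp_all only: of_int_le_iff of_int_less_iff)
  have pb: "k < p1" "k < p3" "p1 < k + 3 * Y" "p3 < k + 3 * Y" using P p1 p3 by auto
  have pos: "0 < real p1" "0 < real p3" using pb by auto
  have b: "n / p1 \<le> a p1" "n / p3 \<le> a p3" "a p1 \<le> n / p1 + 3 * Y / k" "a p3 \<le> n / p3 + 3 * Y / k"
  proof -
    show "n / p1 \<le> a p1" "n / p3 \<le> a p3" using r pos by (simp_all add: field_simps)
    have up: "a p \<le> n / p + 3 * Y / k" if "real_of_int (a p * int p - int n) < real_of_int (int p - int k)" "k < p" "p < k + 3 * Y" for p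
    proof -
      have "a p * real p \<le> n + 3 * Y" using that by simp
      then have "a p \<le> (n + 3 * Y) / p" using that by (simp add: field_simps)
      also have "\<dots> = n / p + 3 * Y / p" by (simp add: add_divide_distrib)
      also have "3 * Y / p \<le> 3 * Y / k" using that Y_pos k_pos by (intro divide_left_mono) auto
      finally show ?thesis by simp
    qed
    show "a p1 \<le> n / p1 + 3 * Y / k" "a p3 \<le> n / p3 + 3 * Y / k" using up pb r by auto
  qed
  have "p1 < p3" using p1 p3 Y_pos by linarith
  have d: "0 \<le> n / p1 - n / p3" "n / p1 - n / p3 \<le> g ^ 10 * (3 * Y / k)"
  proof -
    show "0 \<le> n / p1 - n / p3" using \<open>p1 < p3\<close> pos by (simp add: frac_le)
    have "scale n 0 p1 - scale n 0 p3 \<le> scale n (Suc 0) k * (real p3 - real p1)"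
      using pb \<open>p1 < p3\<close> by (intro scale_diff) auto
    also have "\<dots> \<le> scale n (Suc 0) k * (3 * Y)" using pb by (intro mult_left_mono scale_nonneg) auto
    also have "\<dots> = scale n 0 k * (3 * Y / k)" by (simp add: scale_Suc)
    also have "\<dots> \<le> g ^ 10 * (3 * Y / k)" using assms(1) Y_pos by (intro mult_right_mono) auto
    finally show "n / p1 - n / p3 \<le> g ^ 10 * (3 * Y / k)" by (simp add: scale_def)
  qed
  have small: "g ^ 10 * (3 * Y / k) \<le> 1 / 4" "3 * Y / k \<le> 1 / 4"
  proof -
    have "3 * Y / k \<le> 3 * g ^ 60 / g ^ 100" unfolding k using Y g by (intro divide_right_mono) auto
    also have "\<dots> = 3 / g ^ 40" using g by (simp add: field_simps flip: power_add)
    finally have 1: "3 * Y / k \<le> 3 / g ^ 40" .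
    have "g ^ 10 * (3 * Y / k) \<le> g ^ 10 * (3 / g ^ 40)" using 1 g by (intro mult_left_mono) auto
    also have "\<dots> = 3 / g ^ 30" using g by (simp add: field_simps flip: power_add)
    also have "\<dots> \<le> 3 / g ^ 1" using g g_power(1)[of 1 30] by (intro divide_left_mono) auto
    also have "\<dots> \<le> 1 / 4" using g by (simp add: field_simps)
    finally show s: "g ^ 10 * (3 * Y / k) \<le> 1 / 4" .
    have "1 * (3 * Y / k) \<le> g ^ 10 * (3 * Y / k)" using g_power Y_pos by (intro mult_right_mono) auto
    then show "3 * Y / k \<le> 1 / 4" using s by linarith
  qed
  have "a p1 = a p3" using b d small by linarith
  moreover have "a p1 \<ge> 2"
  proof (rule ccontr)
    assume "\<not> a p1 \<ge> 2"
    then have "a p1 * int p1 \<le> 1 * int p1" by (intro mult_right_mono) auto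
    then have "n \<le> p1" using \<open>a p1 * int p1 \<ge> int n\<close> by linarith
    moreover have "3 * Y \<le> k" using small k_pos by (simp add: field_simps)
    ultimately show False using n pb by linarith
  qed
  ultimately have "2 * (real p3 - real p1) \<le> a p3 * (real p3 - real p1)"
    using \<open>p1 < p3\<close> by (intro mult_right_mono) auto
  also have "\<dots> < real p3 - real k" using r \<open>a p1 = a p3\<close> by (simp add: algebra_simps)
  finally have "real p3 < 2 * real p1 - real k" by (simp add: algebra_simps)
  then show False using p1(2) p3(2) by (simp add: algebra_simps)
qed


text \<open>In the middle range the truncation error is dominated by the other one.\<close>

lemma unit_scale_error:
  assumes "0 \<le> \<nu>" "\<nu> \<le> g ^ 10"
  shows "(g ^ 8 * Y + g ^ 13 * \<nu>) / k \<le> g ^ 9 * Y / k" "g ^ 9 * Y / k \<le> g ^ 69 / g ^ 100"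
proof -
  have "g ^ 13 * \<nu> \<le> g ^ 13 * g ^ 10" using assms g g_power by (intro mult_left_mono) auto
  also have "\<dots> = g ^ 23" by (simp flip: power_add)
  also have "\<dots> \<le> Y" using Y g_power(1)[of 23 40] by auto
  also have "\<dots> = 1 * Y" by simp
  also have "\<dots> \<le> g ^ 8 * Y" using Y_pos g g_power by (intro mult_right_mono) auto
  finally have "g ^ 8 * Y + g ^ 13 * \<nu> \<le> 2 * (g ^ 8 * Y)" by linarith
  also have "\<dots> \<le> g * (g ^ 8 * Y)" using g Y_pos by (intro mult_right_mono) auto
  also have "\<dots> = g ^ 9 * Y" by (simp add: eval_nat_numeral)
  finally show "(g ^ 8 * Y + g ^ 13 * \<nu>) / k \<le> g ^ 9 * Y / k" using k_pos by (intro divide_right_mono) auto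
  have "g ^ 9 * Y \<le> g ^ 9 * g ^ 60" using Y g g_power by (intro mult_left_mono) auto
  also have "\<dots> = g ^ 69" by (simp flip: power_add)
  finally show "g ^ 9 * Y / k \<le> g ^ 69 / g ^ 100" unfolding k using g g_power by (intro divide_right_mono) auto
qed

text \<open>Let \<open>v\<close> and \<open>w\<close> be integers such that \<open>w * scale n (j + 1) x\<close> is close to \<open>v\<close> in every window. In
the relation of order \<open>j\<close> the second term of the expansion is \<open>- (N + j * M / 2) * scale n (j + 1) x\<close>. After multiplication by \<open>w\<close>
one may replace \<open>w * scale n (j + 1) x\<close> by \<open>v\<close>, and then \<open>v * N\<close> is an integer that can be
moved to the other side. Adding the integer \<open>v * x * M\<close> as well makes the remaining function
\<open>G x = w * scale n j x + v * x - v * j / 2\<close> almost flat: its derivative is \<open>v - w * scale n (j + 1) x\<close>. So the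
fractions with denominators \<open>M\<close> that follow \<open>G\<close> can be compared at distances for which
\<open>w * scale n j\<close> itself varies far too much.\<close>

lemma no_unit_scale_on:
  fixes v w :: int
  assumes j: "Suc j \<le> m" and \<nu>: "1 \<le> scale n (Suc j) k * g ^ 14" "scale n (Suc j) k \<le> g ^ 10"
    and \<Omega>: "\<Omega> = \<Omega>\<^sub>1 \<or> \<Omega> = \<Omega>\<^sub>3"
    and w: "1 \<le> w" "real_of_int w \<le> g ^ 13"
    and v: "\<And>x. x \<in> \<Omega> \<Longrightarrow> \<bar>v - w * scale n (Suc j) x\<bar> \<le> g ^ 9 * Y / k"
    and s: "w * scale n (Suc (Suc j)) k * Y / 5 \<le> s" "s \<le> g ^ 9 * Y / k"
    and slope: "\<And>z x x'. x \<in> \<Omega> \<Longrightarrow> x' \<in> \<Omega> \<Longrightarrow> real x \<le> z \<Longrightarrow> z \<le> real x' \<Longrightarrow>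
        s \<le> \<bar>v - w * scale n (Suc j) z\<bar> \<and> \<bar>v - w * scale n (Suc j) z\<bar> \<le> 16 * s"
  shows False
proof -
  define \<nu> where "\<nu> = scale n (Suc j) k"
  define \<tau> where "\<tau> = g ^ 9 * Y / k"
  define G where "G x = w * scale n j x + v * x - v * j / 2" for x :: real
  have l: "1 \<le> \<nu> * g ^ 14" "\<nu> \<le> g ^ 10" "0 \<le> \<nu>" using \<nu> scale_nonneg[of k "Suc j"] by (auto simp: \<nu>_def)
  have \<Omega>': "\<Omega> \<subseteq> \<Omega>\<^sub>1 \<union> \<Omega>\<^sub>3" "finite \<Omega>" "\<rho> * (2 * Y) \<le> card \<Omega>" using \<Omega> \<Omega>\<^sub>1 \<Omega>\<^sub>3 by auto
  have rng: "real k \<le> x" "x \<le> k + 3 * Y" if "x \<in> \<Omega>" for x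
    using \<Omega>' that \<Omega>\<^sub>1(2)[of x] \<Omega>\<^sub>3(2)[of x] Y_pos by auto
  have \<tau>0: "0 < \<tau>" unfolding \<tau>_def using g Y_pos g_power k_pos by (intro divide_pos_pos mult_pos_pos) auto
  have err: "(g ^ 8 * Y + g ^ 13 * \<nu>) / k \<le> \<tau>" unfolding \<tau>_def by (rule unit_scale_error(1)) (use l in auto)
  have "\<exists>Q M. 1 \<le> M \<and> real_of_int M \<le> g ^ 13 \<and> \<bar>real_of_int Q - M * G x\<bar> \<le> g ^ 14 * \<tau>" if x: "x \<in> \<Omega>" for x
  proof -
    have xj: "x \<in> \<Omega>\<^sub>1 \<union> \<Omega>\<^sub>3" "j \<le> m" "j < m" using x \<Omega>' j by auto
    obtain A M N :: int where r0: "1 \<le> M" "M \<le> g ^ 13" "j < m \<Longrightarrow> \<bar>real_of_int N\<bar> \<le> g ^ 13"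
      "j < m \<Longrightarrow> \<bar>A - (M * scale n j x - (real_of_int N + real j * real_of_int M / 2) * scale n (Suc j) x)\<bar>
        \<le> (g ^ 8 * Y + g ^ 13 * scale n (Suc j) k) / k"
      by (rule window[OF xj(1,2)]) blast
    have r: "1 \<le> M" "M \<le> g ^ 13" "\<bar>real_of_int N\<bar> \<le> g ^ 13"
      "\<bar>A - (M * scale n j x - (real_of_int N + real j * real_of_int M / 2) * scale n (Suc j) x)\<bar> \<le> \<tau>"
      using r0(1,2) r0(3,4)[OF xj(3)] err unfolding \<nu>_def by linarith+
    define Q where "Q = w * A + v * (N + int x * M)"
    define e where "e = A - (M * scale n j x - (real_of_int N + real j * real_of_int M / 2) * scale n (Suc j) x)"
    define h where "h = v - w * scale n (Suc j) x"
    have "real_of_int Q - M * G x = w * e + h * (real_of_int N + real j * real_of_int M / 2)"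
      by (simp add: Q_def G_def e_def h_def algebra_simps)
    also have "\<bar>\<dots>\<bar> \<le> \<bar>w * e\<bar> + \<bar>h * (real_of_int N + real j * real_of_int M / 2)\<bar>" by (rule abs_triangle_ineq)
    also have "\<dots> \<le> g ^ 13 * \<tau> + \<tau> * (g ^ 13 + real j * g ^ 13 / 2)"
      unfolding abs_mult
    proof (intro add_mono mult_mono)
      show "\<bar>h\<bar> \<le> \<tau>" using v[OF x] by (simp add: h_def \<tau>_def)
      have "\<bar>real_of_int N + real j * real_of_int M / 2\<bar> \<le> \<bar>real_of_int N\<bar> + \<bar>real j * real_of_int M / 2\<bar>" by (rule abs_triangle_ineq)
      also have "\<dots> \<le> g ^ 13 + real j * g ^ 13 / 2"
        using r by (intro add_mono) (auto simp: abs_mult intro!: mult_left_mono)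
      finally show "\<bar>real_of_int N + real j * real_of_int M / 2\<bar> \<le> g ^ 13 + real j * g ^ 13 / 2" .
    qed (use w r \<tau>0 g g_power in \<open>auto simp: e_def\<close>)
    also have "\<dots> = g ^ 13 * \<tau> * (2 + real j / 2)" by (simp add: algebra_simps)
    also have "\<dots> \<le> g ^ 13 * \<tau> * g" using m j \<tau>0 g g_power by (intro mult_left_mono) auto
    also have "\<dots> = g ^ 14 * \<tau>" by (simp add: eval_nat_numeral)
    finally show ?thesis using r by blast
  qed
  then obtain Q M where QM: "\<And>x. x \<in> \<Omega> \<Longrightarrow> 1 \<le> M x \<and> real_of_int (M x) \<le> g ^ 13 \<and> \<bar>real_of_int (Q x) - M x * G x\<bar> \<le> g ^ 14 * \<tau>"
    by metis
  have s0: "\<nu> * Y / (5 * g ^ 100) \<le> s"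
  proof -
    have "1 * \<nu> * 1 \<le> w * \<nu> * real (Suc (Suc j))" using w l by (intro mult_mono) auto
    then have "\<nu> * (Y / (5 * k)) \<le> w * \<nu> * real (Suc (Suc j)) * (Y / (5 * k))"
      using Y_pos k_pos by (intro mult_right_mono) auto
    also have "\<dots> = w * scale n (Suc (Suc j)) k * Y / 5"
      unfolding scale_Suc[of n "Suc j"] \<nu>_def by (simp add: mult_ac)
    finally have "\<nu> * (Y / (5 * real k)) \<le> s" using s(1) by linarith
    then show ?thesis unfolding k by simp
  qed
  have "0 < \<nu>" using l g_power(2)[of 14] by (smt (verit) mult_eq_0_iff)
  then have s_pos: "0 < s" using s0 Y_pos g_power(2)[of 100] by (smt (verit) divide_pos_pos mult_pos_pos)
  have \<tau>k: "\<tau> \<le> g ^ 69 / g ^ 100" unfolding \<tau>_def by (rule unit_scale_error(2)[OF l(3,2)])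
  have D': "16 * real D \<le> \<rho> * g / 256" "1024 * real D \<le> \<rho> * g / 4" using \<rho> by auto
  show False
  proof (rule two_window_contradiction[of \<Omega> "2 * Y" \<rho> M "g ^ 13" D Q "\<lambda>x. G x" "g ^ 14 * \<tau>" s])
    show "real x - real x' \<le> 2 * Y" if "x \<in> \<Omega>" "x' \<in> \<Omega>" for x x'
      using that \<Omega> \<Omega>\<^sub>1(2)[of x] \<Omega>\<^sub>1(2)[of x'] \<Omega>\<^sub>3(2)[of x] \<Omega>\<^sub>3(2)[of x'] Y_pos by auto
    show "s * (real x' - real x) \<le> \<bar>G x' - G x\<bar> \<and> \<bar>G x' - G x\<bar> \<le> 16 * s * (real x' - real x)"
      if x: "x \<in> \<Omega>" "x' \<in> \<Omega>" "x < x'" for x x'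
    proof -
      have "\<exists>z>real x. z < real x' \<and> G x' - G x = (real x' - real x) * (w * (- scale n (Suc j) z) + v)"
      proof (rule MVT2)
        fix y assume "real x \<le> y" "y \<le> real x'"
        then have y: "0 < y" using rng[OF x(1)] k_pos by linarith
        show "(G has_real_derivative w * (- scale n (Suc j) y) + v) (at y)"
          unfolding G_def[abs_def] by (rule derivative_eq_intros scale_deriv[OF y] refl | simp)+
      qed (use x in simp)
      then obtain z :: real where z: "x < z" "z < x'" "G x' - G x = (real x' - real x) * (v - w * scale n (Suc j) z)"
        by (auto simp: algebra_simps)
      have "\<bar>G x' - G x\<bar> = \<bar>v - w * scale n (Suc j) z\<bar> * (real x' - real x)" unfolding z(3) using x by (simp add: abs_mult)
      then show ?thesis using slope[of x x' z] x z by (auto intro!: mult_right_mono)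
    qed
    show "16 * D * (g ^ 14 * \<tau>) < s * \<rho> * (2 * Y)"
    proof -
      have "16 * D * (g ^ 14 * (g ^ 9 * Y)) \<le> \<rho> * g / 256 * (g ^ 14 * (g ^ 9 * Y))"
        using D' g Y_pos g g_power by (intro mult_right_mono) auto
      also have "\<dots> = \<rho> * Y / 256 * g ^ 24" by (simp add: eval_nat_numeral)
      also have "\<dots> \<le> \<rho> * Y / 256 * (\<nu> * Y)"
      proof (intro mult_left_mono)
        have "g ^ 24 \<le> g ^ 26" by (rule g_power) simp
        also have "\<dots> = 1 * g ^ 26" by simp
        also have "\<dots> \<le> (\<nu> * g ^ 14) * g ^ 26" using l g g_power by (intro mult_right_mono) auto
        also have "\<dots> = \<nu> * g ^ 40" by (simp flip: power_add)
        also have "\<dots> \<le> \<nu> * Y" using l Y by (intro mult_left_mono) auto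
        finally show "g ^ 24 \<le> \<nu> * Y" .
      qed (use \<rho> Y_pos in auto)
      also have "\<dots> < \<nu> * Y / 5 * \<rho> * (2 * Y)" using \<open>0 < \<nu>\<close> \<rho> Y_pos by simp
      finally have "16 * D * (g ^ 14 * (g ^ 9 * Y)) / g ^ 100 < \<nu> * Y / 5 * \<rho> * (2 * Y) / g ^ 100"
        using g_power(2)[of 100] by (intro divide_strict_right_mono) auto
      also have "\<dots> = \<nu> * Y / (5 * g ^ 100) * \<rho> * (2 * Y)" by simp
      also have "\<dots> \<le> s * \<rho> * (2 * Y)" using s0 \<rho> Y_pos by (intro mult_right_mono) auto
      finally show ?thesis by (simp add: \<tau>_def k)
    qed
    show "4096 * D * g ^ 13 * (g ^ 14 * \<tau>) < \<rho>"
    proof -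
      have "4096 * D * g ^ 13 * (g ^ 14 * \<tau>) \<le> \<rho> * g * g ^ 13 * (g ^ 14 * (g ^ 69 / g ^ 100))"
        using \<rho> \<tau>0 \<tau>k g g_power by (intro mult_mono) auto
      also have "\<dots> = \<rho> * (g ^ 97 / g ^ 100)" by (simp add: mult.assoc flip: power_add power_Suc)
      also have "\<dots> < \<rho> * 1"
      proof (rule mult_strict_left_mono)
        have "g ^ 97 < g ^ 100" using g by (intro power_strict_increasing) auto
        then show "g ^ 97 / g ^ 100 < 1" using g_power(2)[of 100] by simp
      qed (use \<rho> in auto)
      finally show ?thesis by simp
    qed
    show "1024 * D * s * (g ^ 13)\<^sup>2 \<le> \<rho>"
    proof -
      have "s \<le> g ^ 69 / g ^ 100" using s \<tau>k by (simp add: \<tau>_def)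
      then have "1024 * D * s * (g ^ 13)\<^sup>2 \<le> \<rho> * g / 4 * (g ^ 69 / g ^ 100) * (g ^ 13)\<^sup>2"
        using D' \<rho> g s_pos by (intro mult_right_mono mult_mono) auto
      also have "\<dots> = \<rho> * (g ^ 96 / (4 * g ^ 100))" by (simp add: eval_nat_numeral)
      also have "\<dots> \<le> \<rho> * 1"
      proof (rule mult_left_mono)
        have "g ^ 96 \<le> g ^ 100" by (rule g_power) simp
        then show "g ^ 96 / (4 * g ^ 100) \<le> 1" using g_power(2)[of 96] by (subst divide_le_eq_1_pos) linarith+
      qed (use \<rho> in auto)
      finally show ?thesis by simp
    qed
  qed (use QM \<Omega>' \<rho> D Y_pos g g_power \<tau>0 few_classes s_pos in auto)
qed

text \<open>The fractions \<open>A / M\<close> of order \<open>j + 1\<close> agree in all windows, because \<open>scale n (j + 1)\<close> changes by less than \<open>1 / g ^ 26\<close>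
between any two of them. The representative with the smallest denominator \<open>w\<close> is chosen, as then
\<open>v - w * scale n (j + 1) x\<close> is no larger than the error in the window of \<open>x\<close>, with no loss of a factor \<open>w\<close>. This difference is an
increasing function of \<open>x\<close> with known rate of growth. According to its sign at a point between \<open>\<Omega>\<^sub>1\<close> and \<open>\<Omega>\<^sub>3\<close>
it stays away from \<open>0\<close>, by a fixed part of its total growth, on one of the two sets.\<close>

lemma no_unit_scale:
  assumes j: "Suc j \<le> m" and \<nu>: "1 \<le> scale n (Suc j) k * g ^ 14" "scale n (Suc j) k \<le> g ^ 10"
  shows False
proof -
  define \<nu> where "\<nu> = scale n (Suc j) k"
  define \<tau> where "\<tau> = g ^ 9 * Y / k"
  define \<Omega> where "\<Omega> = \<Omega>\<^sub>1 \<union> \<Omega>\<^sub>3"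
  have l: "1 \<le> \<nu> * g ^ 14" "\<nu> \<le> g ^ 10" "0 \<le> \<nu>" using \<nu> scale_nonneg[of k "Suc j"] by (auto simp: \<nu>_def)
  have rng: "real k \<le> x" "x \<le> k + 3 * Y" if "x \<in> \<Omega>" for x
    using that \<Omega>\<^sub>1(2)[of x] \<Omega>\<^sub>3(2)[of x] Y_pos by (auto simp: \<Omega>_def)
  have err: "(g ^ 8 * Y + g ^ 13 * \<nu>) / k \<le> \<tau>" unfolding \<tau>_def by (rule unit_scale_error(1)) (use l in auto)
  have "\<exists>A M. 1 \<le> M \<and> real_of_int M \<le> g ^ 13 \<and> \<bar>real_of_int A - M * scale n (Suc j) x\<bar> \<le> \<tau>" if "x \<in> \<Omega>" for x
    using window[of x "Suc j"] that j order.trans[OF _ err] unfolding \<nu>_def \<Omega>_def by metis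
  then obtain A M where AM: "\<And>x. x \<in> \<Omega> \<Longrightarrow> 1 \<le> M x \<and> real_of_int (M x) \<le> g ^ 13 \<and> \<bar>real_of_int (A x) - M x * scale n (Suc j) x\<bar> \<le> \<tau>"
    by metis
  have \<tau>k: "\<tau> \<le> g ^ 69 / g ^ 100" unfolding \<tau>_def by (rule unit_scale_error(2)[OF l(3,2)])
  have cross: "A x * M x' = A x' * M x" if x: "x \<in> \<Omega>" "x' \<in> \<Omega>" for x x'
  proof -
    have d: "\<bar>scale n (Suc j) x - scale n (Suc j) x'\<bar> \<le> g ^ 11 * (3 * Y) / k" if "x \<in> \<Omega>" "x' \<in> \<Omega>" "x < x'" for x x'
    proof -
      have "0 \<le> scale n (Suc (Suc j)) k / 2 * (real x' - real x)" using that by (simp add: scale_nonneg)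
      then have "\<bar>scale n (Suc j) x - scale n (Suc j) x'\<bar> \<le> scale n (Suc (Suc j)) k * (real x' - real x)"
        using scale_diff[OF j, of x x'] that rng[OF that(1)] rng[OF that(2)] by auto
      also have "\<dots> \<le> scale n (Suc (Suc j)) k * (3 * Y)"
        using rng[OF that(1)] rng[OF that(2)] by (intro mult_left_mono scale_nonneg) auto
      also have "\<dots> = \<nu> * real (Suc (Suc j)) * (3 * Y) / k" unfolding scale_Suc[of n "Suc j"] \<nu>_def by simp
      also have "\<dots> \<le> g ^ 10 * g * (3 * Y) / k"
        using l j m Y_pos g by (intro divide_right_mono mult_right_mono mult_mono) auto
      also have "\<dots> = g ^ 11 * (3 * Y) / k" by (simp add: eval_nat_numeral)
      finally show ?thesis .
    qed
    have d': "\<bar>scale n (Suc j) x - scale n (Suc j) x'\<bar> \<le> g ^ 11 * (3 * Y) / k"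
    proof (cases x x' rule: linorder_cases)
      case greater
      then show ?thesis using d[of x' x] x by (simp add: abs_minus_commute)
    qed (use d x Y_pos g in auto)
    define p where "p = real_of_int (M x) * real_of_int (M x')"
    have p: "0 \<le> p" "p \<le> g ^ 13 * g ^ 13"
      using AM[OF x(1)] AM[OF x(2)] g unfolding p_def by - (intro mult_nonneg_nonneg mult_mono; simp)+
    have "A x * M x' - A x' * M x = M x' * (A x - M x * scale n (Suc j) x) - M x * (A x' - M x' * scale n (Suc j) x')
       + p * (scale n (Suc j) x - scale n (Suc j) x')" by (simp add: p_def algebra_simps)
    also have "\<bar>\<dots>\<bar> \<le> \<bar>M x' * (A x - M x * scale n (Suc j) x)\<bar> + \<bar>M x * (A x' - M x' * scale n (Suc j) x')\<bar>
       + \<bar>p * (scale n (Suc j) x - scale n (Suc j) x')\<bar>" by linarith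
    also have "\<dots> \<le> g ^ 13 * \<tau> + g ^ 13 * \<tau> + g ^ 13 * g ^ 13 * (g ^ 11 * (3 * Y) / k)"
      unfolding abs_mult using AM[OF x(1)] AM[OF x(2)] p d' g g_power by (intro add_mono mult_mono) auto
    also have "\<dots> \<le> g ^ 13 * (g ^ 69 / g ^ 100) + g ^ 13 * (g ^ 69 / g ^ 100) + g ^ 13 * g ^ 13 * (g ^ 11 * (3 * g ^ 60) / g ^ 100)"
      unfolding k using \<tau>k Y g by (intro add_mono mult_left_mono divide_right_mono) auto
    also have "\<dots> = (2 * g ^ 82 + 3 * g ^ 97) / g ^ 100" by (simp add: add_divide_distrib flip: power_add)
    also have "\<dots> < 1"
    proof -
      have "g ^ 82 \<le> g ^ 97" by (rule g_power) simp
      moreover have "5 * g ^ 97 < g ^ 3 * g ^ 97" using g g_power(1)[of 1 3] g_power(2)[of 97] by (intro mult_strict_right_mono) auto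
      moreover have "g ^ 3 * g ^ 97 = g ^ 100" by (simp flip: power_add)
      ultimately show ?thesis using g_power(2)[of 100] by (simp add: field_simps)
    qed
    finally have "\<bar>real_of_int (A x * M x' - A x' * M x)\<bar> < 1" by simp
    then show ?thesis by linarith
  qed
  obtain x0 where x0: "x0 \<in> \<Omega>" "\<And>x. x \<in> \<Omega> \<Longrightarrow> M x0 \<le> M x"
  proof -
    have "finite \<Omega>" "\<Omega> \<noteq> {}" using \<Omega>\<^sub>1 \<Omega>\<^sub>3 windows_nonempty by (auto simp: \<Omega>_def)
    then show ?thesis using that arg_min_if_finite[of \<Omega> M] by (metis not_le)
  qed
  define w where "w = M x0"
  define v where "v = A x0"
  have w: "1 \<le> w" "real_of_int w \<le> g ^ 13" using AM[OF x0(1)] by (auto simp: w_def)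
  define H where "H z = real_of_int v - w * scale n (Suc j) z" for z
  have H: "\<bar>H x\<bar> \<le> \<tau>" if x: "x \<in> \<Omega>" for x
  proof -
    have c: "real_of_int v * M x = real_of_int (A x) * w"
      using cross[OF x0(1) x] unfolding v_def w_def by (metis of_int_mult)
    have M: "1 \<le> M x" "w \<le> M x" using AM[OF x] x0(2)[OF x] by (auto simp: w_def)
    have "M x * H x = w * (A x - M x * scale n (Suc j) x)"
      using c by (simp add: H_def algebra_simps)
    then have "M x * \<bar>H x\<bar> = w * \<bar>A x - M x * scale n (Suc j) x\<bar>"
      using M w by (metis abs_mult abs_of_nonneg of_int_0_le_iff order.trans zero_le_one)
    also have "\<dots> \<le> M x * \<tau>" using M w AM[OF x] by (intro mult_mono) auto
    finally show ?thesis using M by simp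
  qed
  define \<delta> where "\<delta> = w * scale n (Suc (Suc j)) k"
  have \<delta>0: "0 \<le> \<delta>" using w scale_nonneg by (simp add: \<delta>_def)
  have inc: "\<delta> / 2 * (z' - z) \<le> H z' - H z" "H z' - H z \<le> \<delta> * (z' - z)" if "real k \<le> z" "z \<le> z'" "z' \<le> k + 3 * Y" for z z'
  proof -
    have "\<delta> / 2 * (z' - z) \<le> H z' - H z \<and> H z' - H z \<le> \<delta> * (z' - z)"
    proof (cases "z = z'")
      case False
      then have "scale n (Suc (Suc j)) k / 2 * (z' - z) \<le> scale n (Suc j) z - scale n (Suc j) z'"
        "scale n (Suc j) z - scale n (Suc j) z' \<le> scale n (Suc (Suc j)) k * (z' - z)"
        using scale_diff[OF j, of z z'] that by auto
      then have "w * (scale n (Suc (Suc j)) k / 2 * (z' - z)) \<le> w * (scale n (Suc j) z - scale n (Suc j) z')"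
        "w * (scale n (Suc j) z - scale n (Suc j) z') \<le> w * (scale n (Suc (Suc j)) k * (z' - z))"
        using w by (auto intro!: mult_left_mono)
      then show ?thesis by (simp add: H_def \<delta>_def algebra_simps)
    qed simp
    then show "\<delta> / 2 * (z' - z) \<le> H z' - H z" "H z' - H z \<le> \<delta> * (z' - z)" by auto
  qed
  \<comment> \<open>halfway between the end of \<open>\<Omega>\<^sub>1\<close> and the beginning of \<open>\<Omega>\<^sub>3\<close>\<close>
  define mid where "mid = k + 29 / 20 * Y"
  have mid: "real k \<le> mid" "mid \<le> k + 3 * Y" using Y_pos by (auto simp: mid_def)
  show False
  proof (cases "H mid \<le> 0")
    case True
    define b where "b = Max \<Omega>\<^sub>1"
    have b: "b \<in> \<Omega>\<^sub>1" "\<And>x. x \<in> \<Omega>\<^sub>1 \<Longrightarrow> x \<le> b" using windows_nonempty \<Omega>\<^sub>1 by (auto simp: b_def)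
    have bk: "real k \<le> b" "b \<le> k + Y" using \<Omega>\<^sub>1(2)[OF b(1)] by auto
    have "\<delta> / 2 * (9 / 20 * Y) \<le> \<delta> / 2 * (mid - b)" using bk \<delta>0 by (intro mult_left_mono) (auto simp: mid_def)
    also have "\<dots> \<le> H mid - H b" using bk mid Y_pos by (intro inc) (auto simp: mid_def)
    finally have sb: "\<delta> * Y / 5 \<le> - H b" using True \<delta>0 Y_pos mult_nonneg_nonneg[OF \<delta>0, of Y] by linarith
    show False
    proof (rule no_unit_scale_on[OF j \<nu> _ w, of \<Omega>\<^sub>1 v "- H b"])
      show "\<bar>v - w * scale n (Suc j) x\<bar> \<le> g ^ 9 * Y / k" if "x \<in> \<Omega>\<^sub>1" for x
        using H[of x] that by (simp add: H_def \<tau>_def \<Omega>_def)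
      show "w * scale n (Suc (Suc j)) k * Y / 5 \<le> - H b" using sb by (simp add: \<delta>_def)
      show "- H b \<le> g ^ 9 * Y / k" using H[of b] b by (simp add: \<Omega>_def \<tau>_def)
      fix z x x' assume x: "x \<in> \<Omega>\<^sub>1" "x' \<in> \<Omega>\<^sub>1" "real x \<le> z" "z \<le> real x'"
      have z: "real k \<le> z" "z \<le> b" using x b(2)[OF x(2)] \<Omega>\<^sub>1(2)[OF x(1)] by auto
      have "0 \<le> \<delta> / 2 * (b - z)" using \<delta>0 z by simp
      also have "\<dots> \<le> H b - H z" using z bk Y_pos by (intro inc) auto
      finally have 1: "H z \<le> H b" by simp
      have "H b - H z \<le> \<delta> * (b - z)" using z bk Y_pos by (intro inc) auto
      also have "\<dots> \<le> \<delta> * Y" using z bk \<delta>0 by (intro mult_left_mono) auto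
      finally have 2: "- H z \<le> 6 * (- H b)" using sb by linarith
      show "- H b \<le> \<bar>v - w * scale n (Suc j) z\<bar> \<and> \<bar>v - w * scale n (Suc j) z\<bar> \<le> 16 * - H b"
        using 1 2 sb mult_nonneg_nonneg[OF \<delta>0, of Y] Y_pos unfolding H_def[symmetric] by auto
    qed simp
  next
    case False
    define b where "b = Min \<Omega>\<^sub>3"
    have b: "b \<in> \<Omega>\<^sub>3" "\<And>x. x \<in> \<Omega>\<^sub>3 \<Longrightarrow> b \<le> x" using windows_nonempty \<Omega>\<^sub>3 by (auto simp: b_def)
    have bk: "k + 19 / 10 * Y \<le> b" "b \<le> k + 3 * Y" using \<Omega>\<^sub>3(2)[OF b(1)] by auto
    have "\<delta> / 2 * (9 / 20 * Y) \<le> \<delta> / 2 * (b - mid)" using bk \<delta>0 by (intro mult_left_mono) (auto simp: mid_def)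
    also have "\<dots> \<le> H b - H mid" using bk mid Y_pos by (intro inc) (auto simp: mid_def)
    finally have sb: "\<delta> * Y / 5 \<le> H b" using False \<delta>0 Y_pos mult_nonneg_nonneg[OF \<delta>0, of Y] by linarith
    show False
    proof (rule no_unit_scale_on[OF j \<nu> _ w, of \<Omega>\<^sub>3 v "H b"])
      show "\<bar>v - w * scale n (Suc j) x\<bar> \<le> g ^ 9 * Y / k" if "x \<in> \<Omega>\<^sub>3" for x
        using H[of x] that by (simp add: H_def \<tau>_def \<Omega>_def)
      show "w * scale n (Suc (Suc j)) k * Y / 5 \<le> H b" using sb by (simp add: \<delta>_def)
      show "H b \<le> g ^ 9 * Y / k" using H[of b] b by (simp add: \<Omega>_def \<tau>_def)
      fix z x x' assume x: "x \<in> \<Omega>\<^sub>3" "x' \<in> \<Omega>\<^sub>3" "real x \<le> z" "z \<le> real x'"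
      have z: "b \<le> z" "z \<le> k + 3 * Y" using x b(2)[OF x(1)] \<Omega>\<^sub>3(2)[OF x(2)] by auto
      have "0 \<le> \<delta> / 2 * (z - b)" using \<delta>0 z by simp
      also have "\<dots> \<le> H z - H b" using z bk Y_pos by (intro inc) auto
      finally have 1: "H b \<le> H z" by simp
      have "H z - H b \<le> \<delta> * (z - b)" using z bk Y_pos by (intro inc) auto
      also have "\<dots> \<le> \<delta> * (2 * Y)" using z bk \<delta>0 Y_pos by (intro mult_left_mono) auto
      finally have 2: "H z \<le> 11 * H b" using sb by linarith
      show "H b \<le> \<bar>v - w * scale n (Suc j) z\<bar> \<and> \<bar>v - w * scale n (Suc j) z\<bar> \<le> 16 * H b"
        using 1 2 sb mult_nonneg_nonneg[OF \<delta>0, of Y] Y_pos unfolding H_def[symmetric] by auto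
    qed simp
  qed
qed

text \<open>Take the least \<open>i\<close> with \<open>scale n i k \<le> g ^ 70\<close>. By minimality \<open>scale n i k\<close> is at least \<open>g ^ 70 / k = 1 / g ^ 30\<close> unless \<open>i = 0\<close>, and
the ranges of the preceding lemmas cover what is left.\<close>

lemma no_near_multiples:
  assumes top: "scale n m k \<le> g ^ 70" and p1: "p1 \<in> P" "real p1 < k + Y" and p3: "p3 \<in> P" "real k + 2 * Y < p3"
  shows False
proof -
  define i where "i = (LEAST i. scale n i k \<le> g ^ 70)"
  have i: "scale n i k \<le> g ^ 70" "i \<le> m" unfolding i_def using top by (rule LeastI, rule Least_le)
  have prev: "g ^ 70 < scale n j k" if "j < i" for j using that unfolding i_def by (metis not_le not_less_Least)
  show False
  proof (cases "g ^ 10 \<le> scale n i k")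
    case True then show False using no_large_scale i by blast
  next
    case False
    then have small: "scale n i k \<le> g ^ 10" by simp
    show False
    proof (cases i)
      case 0 then show False using no_smallest_scale small p1 p3 by blast
    next
      case (Suc j)
      have "g ^ 70 * 1 / g ^ 100 \<le> scale n j k * real (Suc j) / g ^ 100"
        using prev[of j] Suc g_power scale_nonneg[of k j] by (intro divide_right_mono mult_mono) auto
      also have "\<dots> = scale n i k" unfolding Suc scale_Suc k ..
      finally have "g ^ 70 / g ^ 100 * g ^ 30 \<le> scale n i k * g ^ 30" using g g_power by (intro mult_right_mono) auto
      moreover have "g ^ 70 / g ^ 100 * g ^ 30 = 1" using g by (simp add: field_simps flip: power_add)
      ultimately have low: "1 \<le> scale n i k * g ^ 30" by simp
      show False
      proof (cases "scale n i k * g ^ 14 \<le> 1")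
        case True then show False using no_tiny_scale low i by blast
      next
        case False
        then show False using no_unit_scale[of j] small i Suc by auto
      qed
    qed
  qed
qed

end

section \<open>Choice of the parameters\<close>

lemma growth_exp: "1 \<le> q \<Longrightarrow> growth m q = exp (m + m * ln q)"
  by (simp add: growth_def exp_add exp_of_nat_mult)

lemma weight_exp:
  assumes "1 \<le> q"
  shows "weight m q = exp (ln 2 + 2 * ln (2 * real m + 1) + 2 * m + 3 / 2 * m * ln q)"
proof -
  have "sqrt (real q) = exp (ln q / 2)"
    using assms by (metis ln_sqrt exp_ln of_nat_0_less_iff real_sqrt_gt_zero less_le_trans zero_less_one of_nat_0_le_iff)
  then have "sqrt (real q) ^ m = exp (m * (ln q / 2))" by (simp only: exp_of_nat_mult)
  moreover have "real (2 * m + 1) ^ 2 = exp (2 * ln (2 * real m + 1))"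
    by (simp add: exp_double add.commute add_pos_nonneg)
  ultimately have "weight m q = exp (ln 2) * exp (2 * ln (2 * real m + 1)) * exp m * exp (m * (ln q / 2)) * exp (m + m * ln q)"
    by (simp add: weight_def growth_exp[OF assms])
  also have "\<dots> = exp (ln 2 + 2 * ln (2 * real m + 1) + m + m * (ln q / 2) + (m + m * ln q))" by (simp only: exp_add)
  finally show ?thesis by (simp add: algebra_simps)
qed

text \<open>With \<open>y = ln k\<close> and \<open>M\<close> about \<open>y / (20 * ln y)\<close>, the products \<open>m * ln q\<close> are at most \<open>51 / 1000 * y\<close>, up to lower-order terms. Hence the
weight has exponent \<open>3 / 2 * 51 / 1000 < 8 / 100\<close> and its product with \<open>growth m q\<close> has exponent
\<open>5 / 2 * 51 / 1000 < 13 / 100\<close>.\<close>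

lemma parameter_bounds:
  fixes y M :: real
  assumes "1 \<le> m" "real m \<le> M" "2 \<le> q" "real q \<le> y powr (51 / 50)" "1 < y" "real D \<le> y + 1"
    and "ln 6 + 2 * ln (2 * M + 1) + 2 * M + 3 / 2 * (51 / 50) * ln y * M \<le> 8 / 100 * y"
    and "ln 2 + 2 * ln (2 * M + 1) + 3 * M + 5 / 2 * (51 / 50) * ln y * M + ln M + 51 / 50 * ln y \<le> 13 / 100 * y"
    and "ln 2048 + ln (y + 1) + 2 * (51 / 50) * ln y + ln M \<le> y / 100"
  shows "3 * weight m q \<le> exp (8 / 100 * y)"
    "weight m q * growth m q * real (m * q) \<le> exp (13 / 100 * y)"
    "2048 * real D * real q ^ 2 * real m \<le> exp (y / 100)"
proof -
  have q1: "1 \<le> q" using assms by simp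
  define Q where "Q = ln (real q)"
  have "Q \<le> ln (y powr (51 / 50))" unfolding Q_def using assms by (subst ln_le_cancel_iff) auto
  then have Q: "0 \<le> Q" "Q \<le> 51 / 50 * ln y" using assms by (auto simp: Q_def ln_powr)
  have mQ: "real m * Q \<le> 51 / 50 * ln y * M" using mult_mono[OF assms(2) Q(2)] Q assms by (simp add: mult_ac)
  have lm: "ln (2 * real m + 1) \<le> ln (2 * M + 1)" "ln (real m) \<le> ln M" using assms by auto
  have "3 * weight m q = exp (ln 3 + (ln 2 + 2 * ln (2 * real m + 1) + 2 * m + 3 / 2 * m * Q))"
    unfolding weight_exp[OF q1] exp_add[of "ln 3"] Q_def by simp
  also have "\<dots> \<le> exp (8 / 100 * y)"
  proof -
    have "ln 6 = ln 3 + ln (2::real)" using ln_mult[of 3 "2::real"] by simp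
    then show ?thesis using assms(2,7) mQ lm unfolding exp_le_cancel_iff by linarith
  qed
  finally show "3 * weight m q \<le> exp (8 / 100 * y)" .
  have "real (m * q) = exp (ln m + Q)" unfolding Q_def exp_add using assms by simp
  then have "weight m q * growth m q * real (m * q) =
     exp (ln 2 + 2 * ln (2 * real m + 1) + 2 * m + 3 / 2 * m * Q) * exp (m + m * Q) * exp (ln m + Q)"
    unfolding weight_exp[OF q1] growth_exp[OF q1] Q_def by simp
  also have "\<dots> = exp (ln 2 + 2 * ln (2 * real m + 1) + 2 * m + 3 / 2 * m * Q + (m + m * Q) + (ln m + Q))"
    by (simp only: exp_add)
  also have "\<dots> \<le> exp (13 / 100 * y)" using assms(2,8) mQ lm Q unfolding exp_le_cancel_iff by linarith
  finally show "weight m q * growth m q * real (m * q) \<le> exp (13 / 100 * y)" .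
  have "2048 * real D * real q ^ 2 * real m \<le> 2048 * (y + 1) * (y powr (51 / 50)) ^ 2 * M"
    using assms by (intro mult_mono power_mono) auto
  also have "\<dots> = exp (ln 2048) * exp (ln (y + 1)) * exp (51 / 50 * ln y) ^ 2 * exp (ln M)"
    using assms by (simp add: powr_def)
  also have "exp (51 / 50 * ln y) ^ 2 = exp (2 * (51 / 50 * ln y))" by (rule exp_double[symmetric])
  also have "exp (ln 2048) * exp (ln (y + 1)) * exp (2 * (51 / 50 * ln y)) * exp (ln M) =
     exp (ln 2048 + ln (y + 1) + 2 * (51 / 50 * ln y) + ln M)" by (simp only: exp_add)
  also have "\<dots> \<le> exp (y / 100)" using assms by simp
  finally show "2048 * real D * real q ^ 2 * real m \<le> exp (y / 100)" .
qed

text \<open>If \<open>p\<close> does not divide \<open>n\<close> and \<open>r = n mod p\<close> were at most \<open>k\<close>, then \<open>p\<close> would divide the factor \<open>n - r\<close>.\<close>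

lemma multiple_above:
  assumes p: "\<not> p dvd (\<Prod>i=1..k. n - i)" "k < p"
  shows "\<exists>a::int. 0 \<le> a * int p - int n \<and> a * int p - int n < int p - int k"
proof (cases "p dvd n")
  case True
  then show ?thesis using p by (intro exI[of _ "int (n div p)"]) (auto simp flip: of_nat_mult)
next
  case False
  define r where "r = n mod p"
  have r: "0 < r" "r < p" using False p by (auto simp: r_def mod_greater_zero_iff_not_dvd)
  have n: "n = (n div p) * p + r" by (simp add: r_def)
  have "k < r"
  proof (rule ccontr)
    assume "\<not> k < r"
    then have "r \<in> {1..k}" using r by auto
    then have "n - r dvd (\<Prod>i=1..k. n - i)" by (intro dvd_prodI) auto
    moreover have "p dvd n - r" by (simp add: r_def minus_mod_eq_div_mult)
    ultimately show False using p dvd_trans by blast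
  qed
  have "(int (n div p) + 1) * int p - int n = int p - int r"
    by (subst (2) n) (simp add: algebra_simps)
  then show ?thesis using r \<open>k < r\<close> by (intro exI[of _ "int (n div p) + 1"]) auto
qed

lemma rich_windows:
  assumes P: "finite P" "\<And>p. p \<in> P \<Longrightarrow> y \<le> p \<and> real p < real y + Y + 1"
    and L: "1 \<le> m" "1 \<le> q" "real (m * q) \<le> Y" and Y: "4 \<le> Y" and card: "real (card P) \<ge> 16 * Y / real q"
  obtains \<Omega> where "finite \<Omega>" "\<And>x. x \<in> \<Omega> \<Longrightarrow> y \<le> x"
    "\<And>x. x \<in> \<Omega> \<Longrightarrow> 2 * m < card {t. t < m * q \<and> x + t \<in> P}"
    "2 / (real q ^ 2 * real m) * (2 * Y) \<le> real (card \<Omega>)"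
proof -
  define Z where "Z = nat \<lceil>Y\<rceil> + 1"
  have Z: "Y \<le> real Z" "real Z \<le> 2 * Y" using Y unfolding Z_def by linarith+
  have PZ: "P \<subseteq> {y..<y + Z}"
  proof
    fix p assume "p \<in> P"
    then have "y \<le> p" "real p < real (y + Z)" using P(2)[of p] Y unfolding Z_def by (auto, linarith)
    then show "p \<in> {y..<y + Z}" by simp
  qed
  have "real (m * q) \<le> real Z" using L Z by linarith
  then have LZ: "m * q \<le> Z" by (simp only: of_nat_le_iff)
  have "8 * real Z / real q \<le> 8 * (2 * Y) / real q" using Z by (intro divide_right_mono mult_left_mono) auto
  then have cd: "8 * real Z / real q \<le> real (card P)" using card by simp
  have mq: "1 \<le> m * q" using L by simp
  obtain \<Omega> where \<Omega>: "finite \<Omega>" "\<Omega> \<subseteq> {y..<y + Z}" 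
    "\<And>x. x \<in> \<Omega> \<Longrightarrow> 2 * m < card {t. t < m * q \<and> x + t \<in> P}"
    "real (card \<Omega>) \<ge> 4 * real Z / (real q * real (m * q))"
    using rich_cells[OF PZ refl mq LZ cd] by blast
  have "2 / (real q ^ 2 * real m) * (2 * Y) = 4 * Y / (real q * real (m * q))" by (simp add: power2_eq_square)
  also have "\<dots> \<le> 4 * real Z / (real q * real (m * q))" using Z by (intro divide_right_mono) auto
  also have "\<dots> \<le> real (card \<Omega>)" by (rule \<Omega>(4))
  finally show ?thesis by (intro that[OF \<Omega>(1) _ \<Omega>(3)]) (use \<Omega>(2) in auto)
qed

text \<open>The primes between \<open>k + 2 * Y\<close> and \<open>k + 3 * Y\<close> are counted through the interval of length \<open>z powr \<theta>\<close> that starts at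
\<open>z \<approx> k + 2 * Y\<close>. It ends beyond \<open>k + 3 * Y\<close>, but only by about \<open>2 * Y\<^sup>2 / k\<close>, so the integers in excess are
few compared with \<open>Y / ln k\<close>.\<close>

lemma tail_interval_count:
  fixes k z :: nat and c \<theta> Y y :: real
  defines "Y \<equiv> real k powr \<theta>"
    and "z \<equiv> nat \<lfloor>real k + 2 * real k powr \<theta>\<rfloor>" and "y \<equiv> ln (real k)"
  assumes \<theta>: "2 / 5 < \<theta>" "\<theta> < 3 / 5" and y: "1 \<le> y" and small: "3 * Y \<le> k" and c: "0 < c"
    and count: "real (card {p::nat. prime p \<and> z < p \<and> real p < real z + real z powr \<theta>}) \<ge> c * (real z powr \<theta> / ln (real z))"
  shows "real (card {p::nat. prime p \<and> real k + 2 * Y < p \<and> real p < real k + 3 * Y}) \<ge> c / (2 * y) * Y - 4 * exp (- 2 / 5 * y) * Y"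
proof -
  have k0: "0 < real k" using y by (cases k) (auto simp: y_def)
  have k1: "1 \<le> real k" using k0 by simp
  have Y0: "1 \<le> Y" unfolding Y_def using k1 \<theta> by (intro ge_one_powr_ge_zero) auto
  have z: "real z \<le> real k + 2 * Y" "real k + 2 * Y < real z + 1" "real k \<le> real z"
    using Y0 unfolding z_def Y_def by (linarith, linarith, linarith)
  have z2: "real z \<le> real k * real k"
  proof -
    have "exp 1 \<le> real k" using y k0 unfolding y_def by (metis exp_ln exp_le_cancel_iff)
    then have "2 \<le> real k" using exp_ge_add_one_self[of 1] by linarith
    then have "2 * real k \<le> real k * real k" by (intro mult_right_mono) auto
    then show ?thesis using z small by linarith
  qed
  define S where "S = {p::nat. prime p \<and> z < p \<and> real p < real z + real z powr \<theta>}"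
  define P where "P = {p::nat. prime p \<and> real k + 2 * Y < p \<and> real p < real k + 3 * Y}"
  define R where "R = {p::nat. real k + 3 * Y \<le> p \<and> real p < real z + real z powr \<theta>}"
  have finite_below: "finite {p::nat. real p < u}" for u
    by (rule finite_subset[of _ "{..nat \<lceil>u\<rceil>}"]) (auto, linarith)
  have fin: "finite P" "finite R" using finite_below[of "real k + 3 * Y"] finite_below[of "real z + real z powr \<theta>"]
    by (auto simp: P_def R_def elim!: finite_subset[rotated])
  \<comment> \<open>the set \<open>R\<close> collects the integers by which the interval from \<open>z\<close> overshoots\<close>
  have "S \<subseteq> P \<union> R"
  proof
    fix p assume "p \<in> S"
    moreover from this have "real z + 1 \<le> real p" by (simp add: S_def)
    ultimately show "p \<in> P \<union> R" using z by (auto simp: S_def P_def R_def)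
  qed
  then have "card S \<le> card P + card R" using fin by (metis card_Un_le card_mono finite_UnI order.trans)
  then have S: "real (card S) \<le> real (card P) + real (card R)" by (simp flip: of_nat_add)
  have zt: "Y \<le> real z powr \<theta>" unfolding Y_def using z k0 \<theta> by (intro powr_mono2) auto
  have zt2: "real z powr \<theta> \<le> Y + 2 * Y * exp (- 2 / 5 * y)"
  proof -
    have "real k * (1 + 2 * Y / k) = real k + 2 * Y" using k0 by (simp add: field_simps)
    then have "real z powr \<theta> \<le> (real k * (1 + 2 * Y / k)) powr \<theta>" using z \<theta> k0 by (intro powr_mono2) auto
    also have "\<dots> = Y * (1 + 2 * Y / k) powr \<theta>" using k0 Y0 by (simp add: powr_mult Y_def)
    also have "\<dots> \<le> Y * (1 + 2 * Y / k) powr 1" using k0 Y0 \<theta> by (intro mult_left_mono powr_mono) auto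
    also have "\<dots> = Y * (1 + 2 * (Y / k))" using k0 Y0 by simp
    also have "\<dots> \<le> Y * (1 + 2 * exp (- 2 / 5 * y))"
    proof -
      have "Y / k = exp ((\<theta> - 1) * y)" using k0 by (simp add: Y_def y_def powr_def exp_diff left_diff_distrib)
      also have "\<dots> \<le> exp (- 2 / 5 * y)" using \<theta> y mult_right_mono[of "\<theta> - 1" "- 2 / 5" y] by simp
      finally show ?thesis using Y0 by (intro mult_left_mono add_left_mono) auto
    qed
    finally show ?thesis by (simp add: algebra_simps)
  qed
  have "real (card R) \<le> 2 * Y * exp (- 2 / 5 * y) + 1"
  proof -
    define lo where "lo = nat \<lceil>real k + 3 * Y\<rceil>"
    define hi where "hi = nat \<lceil>real z + real z powr \<theta>\<rceil>"
    have "R \<subseteq> {lo..<hi}" unfolding R_def lo_def hi_def by (auto simp: nat_le_iff ceiling_le_iff zless_nat_eq_int_zless less_ceiling_iff)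
    then have "card R \<le> hi - lo" using card_mono[of "{lo..<hi}" R] by simp
    moreover have "real (hi - lo) \<le> 2 * Y * exp (- 2 / 5 * y) + 1"
    proof (cases "hi \<le> lo")
      case False
      then have "real (hi - lo) = real hi - real lo" by (simp add: of_nat_diff)
      moreover have "real hi \<le> real z + real z powr \<theta> + 1" "real k + 3 * Y \<le> real lo"
      proof -
        have "0 \<le> real z + real z powr \<theta>" by simp
        then show "real hi \<le> real z + real z powr \<theta> + 1" unfolding hi_def by linarith
        show "real k + 3 * Y \<le> real lo" unfolding lo_def by (rule real_nat_ceiling_ge)
      qed
      ultimately show ?thesis using z zt2 by linarith
    qed (use Y0 in simp)
    ultimately show ?thesis by linarith
  qed
  moreover have "1 \<le> exp (- 2 / 5 * y) * Y"
  proof -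
    have "exp (- 2 / 5 * y) * Y = exp ((\<theta> - 2 / 5) * y)" using k0 by (simp add: Y_def y_def powr_def algebra_simps flip: exp_add)
    then show ?thesis using \<theta> y by simp
  qed
  ultimately have R: "real (card R) \<le> 4 * exp (- 2 / 5 * y) * Y" by (simp add: mult_ac)
  have "c / (2 * y) * Y = c * (Y / (2 * y))" by simp
  also have "\<dots> \<le> c * (real z powr \<theta> / ln (real z))"
  proof (intro mult_left_mono frac_le zt)
    have "ln (real z) \<le> ln (real k * real k)" using z2 z k0 by (subst ln_le_cancel_iff) auto
    then show "ln (real z) \<le> 2 * y" using k0 by (simp add: ln_mult y_def)
    show "0 < ln (real z)" using y z k0 unfolding y_def by (smt (verit) ln_le_cancel_iff)
  qed (use c Y0 in auto)
  also have "\<dots> \<le> real (card S)" using count by (simp add: S_def)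
  finally show ?thesis using S R unfolding P_def by linarith
qed

text \<open>The conditions on \<open>y = ln k\<close> under which the parameters below work. The last one says that \<open>q\<close>, of size
\<open>y powr (51 / 50)\<close>, outgrows the mean distance \<open>y / c\<close> of the primes by a large constant factor.\<close>

lemma eventually_parameters:
  fixes c :: real assumes "c > 0"
  shows "eventually (\<lambda>y::real. 1 < y \<and>
    ln 6 + 2 * ln (2 * (y / (20 * ln y) + 1) + 1) + 2 * (y / (20 * ln y) + 1) + 3 / 2 * (51 / 50) * ln y * (y / (20 * ln y) + 1) \<le> 8 / 100 * y \<and>
    ln 2 + 2 * ln (2 * (y / (20 * ln y) + 1) + 1) + 3 * (y / (20 * ln y) + 1) + 5 / 2 * (51 / 50) * ln y * (y / (20 * ln y) + 1)
      + ln (y / (20 * ln y) + 1) + 51 / 50 * ln y \<le> 13 / 100 * y \<and>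
    ln 2048 + ln (y + 1) + 2 * (51 / 50) * ln y + ln (y / (20 * ln y) + 1) \<le> y / 100 \<and>
    y / (20 * ln y) + 4 \<le> exp (y / 100) \<and> 100 \<le> exp (y / 100) \<and>
    y / (20 * ln y) + 4 \<le> y powr (51 / 50) \<and>
    32 * y / (y powr (51 / 50) - 1) + 8 * y * exp (- 2 / 5 * y) \<le> c) at_top"
proof -
  have "((\<lambda>y::real. 32 * y / (y powr (51 / 50) - 1) + 8 * y * exp (- 2 / 5 * y)) \<longlongrightarrow> 0) at_top" by real_asymp
  then have "eventually (\<lambda>y::real. 32 * y / (y powr (51 / 50) - 1) + 8 * y * exp (- 2 / 5 * y) \<le> c) at_top"
    using assms by (rule order_tendstoD(2)[THEN eventually_mono]) auto
  then show ?thesis by (intro eventually_conj; (assumption | real_asymp))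
qed

text \<open>The locale is instantiated with \<open>m \<approx> ln k / (20 * ln (ln k))\<close> and \<open>q \<approx> (ln k) powr (51 / 50)\<close>. The bound on \<open>n\<close> gives
\<open>n \<le> k ^ m\<close>, so \<open>scale n m k\<close> is small and all relevant orders are at most \<open>m\<close>.\<close>

lemma prime_divisor_in_short_interval:
  fixes k z n :: nat and c \<theta> y Y :: real
  defines "y \<equiv> ln (real k)" and "Y \<equiv> real k powr \<theta>" and "z \<equiv> nat \<lfloor>real k + 2 * real k powr \<theta>\<rfloor>"
  assumes \<theta>: "2 / 5 < \<theta>" "\<theta> < 3 / 5" and c: "0 < c" and y: "1 < y"
    and par: "ln 6 + 2 * ln (2 * (y / (20 * ln y) + 1) + 1) + 2 * (y / (20 * ln y) + 1) + 3 / 2 * (51 / 50) * ln y * (y / (20 * ln y) + 1) \<le> 8 / 100 * y"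
    "ln 2 + 2 * ln (2 * (y / (20 * ln y) + 1) + 1) + 3 * (y / (20 * ln y) + 1) + 5 / 2 * (51 / 50) * ln y * (y / (20 * ln y) + 1)
      + ln (y / (20 * ln y) + 1) + 51 / 50 * ln y \<le> 13 / 100 * y"
    "ln 2048 + ln (y + 1) + 2 * (51 / 50) * ln y + ln (y / (20 * ln y) + 1) \<le> y / 100"
    and gm: "y / (20 * ln y) + 4 \<le> exp (y / 100)" and g100: "100 \<le> exp (y / 100)"
    and qm: "y / (20 * ln y) + 4 \<le> y powr (51 / 50)"
    and dens: "32 * y / (y powr (51 / 50) - 1) + 8 * y * exp (- 2 / 5 * y) \<le> c"
    and countk: "real (card {p::nat. prime p \<and> k < p \<and> real p < real k + real k powr \<theta>}) \<ge> c * (real k powr \<theta> / ln (real k))"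
    and countz: "real (card {p::nat. prime p \<and> z < p \<and> real p < real z + real z powr \<theta>}) \<ge> c * (real z powr \<theta> / ln (real z))"
    and n: "2 * k < n" "real n \<le> exp ((ln (real k))\<^sup>2 / (20 * ln (ln (real k))))"
  shows "\<exists>p::nat. prime p \<and> k < p \<and> real p < real k + 3 * real k powr \<theta> \<and> p dvd (\<Prod>i=1..k. n - i)"
proof (rule ccontr)
  assume none: "\<not> ?thesis"
  define g where "g = exp (y / 100)"
  define m where "m = nat \<lceil>y / (20 * ln y)\<rceil>"
  define q where "q = nat \<lfloor>y powr (51 / 50)\<rfloor>"
  define D where "D = nat \<lceil>y\<rceil>"
  define \<rho> where "\<rho> = 2 / (real q ^ 2 * real m)"
  have k0: "0 < real k" using y by (cases k) (auto simp: y_def)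
  have kg: "real k = g ^ 100" using k0 by (simp add: g_def y_def flip: exp_of_nat_mult)
  have gp: "g ^ i = exp (real i * (y / 100))" for i by (simp only: g_def exp_of_nat_mult)
  have Yy: "Y = exp (\<theta> * y)" using k0 by (simp add: Y_def y_def powr_def)
  have Yg: "g ^ 40 \<le> Y" "Y \<le> g ^ 60" using \<theta> y unfolding gp Yy by auto
  have g: "100 \<le> g" using g100 by (simp add: g_def)
  have gpow: "g ^ i \<le> g ^ j" if "i \<le> j" for i j using g that by (intro power_increasing) auto
  have g1: "1 \<le> g ^ i" for i using g by (simp add: one_le_power)
  have Y100: "100 \<le> Y" using gpow[of 1 40] g Yg by simp
  have E: "0 < y / (20 * ln y)" using y by simp
  have m: "1 \<le> m" "real m \<le> y / (20 * ln y) + 1" "y / (20 * ln y) \<le> m" using E unfolding m_def by linarith+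
  have q: "4 \<le> q" "real q \<le> y powr (51 / 50)" "y powr (51 / 50) - 1 \<le> q" "m \<le> q"
    using qm E m(2) unfolding q_def by linarith+
  have D: "y \<le> D" "real D \<le> y + 1" "1 \<le> D" using y unfolding D_def by linarith+
  have q2: "2 \<le> q" using q by simp
  note bounds = parameter_bounds[OF m(1,2) q2 q(2) y D(2) par]
  have b: "3 * weight m q \<le> g ^ 8" "weight m q * growth m q * real (m * q) \<le> g ^ 13"
    "2048 * real D * real q ^ 2 * real m \<le> g"
    by (rule order.trans[OF bounds(1)], simp add: gp, rule order.trans[OF bounds(2)], simp add: gp,
        rule order.trans[OF bounds(3)], simp add: g_def)
  have q1: "1 \<le> q" using q by simp
  have wg: "weight m q * growth m q \<le> g ^ 13" "real (m * q) \<le> g ^ 13" "growth m q \<le> g ^ 13"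
  proof -
    have w: "1 \<le> weight m q" "1 \<le> growth m q" using weight_ge_1 growth_ge_1 q1 by auto
    have mq: "1 \<le> real (m * q)" using m q1 by (simp flip: of_nat_mult)
    have "weight m q * growth m q * 1 \<le> weight m q * growth m q * real (m * q)"
      using w mq by (intro mult_left_mono) auto
    then show wg: "weight m q * growth m q \<le> g ^ 13" using b by linarith
    have "1 * growth m q \<le> weight m q * growth m q" using w by (intro mult_right_mono) auto
    then show "growth m q \<le> g ^ 13" using wg by linarith
    have "1 * 1 * real (m * q) \<le> weight m q * growth m q * real (m * q)"
      using w mq by (intro mult_mono) auto
    then show "real (m * q) \<le> g ^ 13" using b by linarith
  qed
  have mqY: "real (m * q) \<le> Y" using wg(2) gpow[of 13 40] Yg by simp
  define P1 where "P1 = {p::nat. prime p \<and> k < p \<and> real p < real k + Y}"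
  define P3 where "P3 = {p::nat. prime p \<and> real k + 2 * Y < p \<and> real p < real k + 3 * Y}"
  have small: "3 * Y \<le> k"
  proof -
    have "3 * Y \<le> g * g ^ 60" using Yg Y100 g by (intro mult_mono) auto
    also have "\<dots> = g ^ 61" by (simp flip: power_Suc)
    also have "\<dots> \<le> g ^ 100" by (rule gpow) simp
    finally show ?thesis using kg by simp
  qed
  have q16: "16 * Y / q \<le> c / (2 * y) * Y - 4 * exp (- 2 / 5 * y) * Y"
  proof -
    have "32 * y / q \<le> 32 * y / (y powr (51 / 50) - 1)"
    proof (intro divide_left_mono mult_pos_pos)
      show "y powr (51 / 50) - 1 \<le> q" by (rule q(3))
      show "0 < real q" using q1 by simp
      show "0 < y powr (51 / 50) - 1" using qm E by linarith
    qed (use y in auto)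
    then have "32 * y / q + 8 * y * exp (- 2 / 5 * y) \<le> c" using dens by linarith
    then have "(32 * y / q + 8 * y * exp (- 2 / 5 * y)) * (Y / (2 * y)) \<le> c * (Y / (2 * y))"
      using y Y100 by (intro mult_right_mono) auto
    moreover have "(32 * y / q + 8 * y * e) * (Y / (2 * y)) = 16 * Y / q + 4 * e * Y" for e
      using y q1 by (simp add: field_simps)
    ultimately show ?thesis by simp
  qed
  have c1: "16 * Y / q \<le> real (card P1)"
  proof -
    have "c / (2 * y) * Y \<le> c * (Y / y)" using c y Y100 by (simp add: field_simps)
    also have "\<dots> \<le> real (card P1)" using countk by (simp add: P1_def Y_def y_def)
    finally have "c / (2 * y) * Y \<le> real (card P1)" .
    moreover have "0 \<le> 4 * exp (- 2 / 5 * y) * Y" using Y100 by simp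
    ultimately show ?thesis using q16 by linarith
  qed
  have c3: "16 * Y / q \<le> real (card P3)"
    using tail_interval_count[OF \<theta>, of k c] countz y small c q16
    unfolding P3_def Y_def y_def z_def by force
  have z: "real k + 2 * Y - 1 \<le> z" "real z \<le> real k + 2 * Y" using Y100 unfolding z_def Y_def by linarith+
  have finite_below: "finite {p::nat. real p < u}" for u
    by (rule finite_subset[of _ "{..nat \<lceil>u\<rceil>}"]) (auto, linarith)
  have fin: "finite P1" "finite P3" unfolding P1_def P3_def
    by (auto intro: finite_subset[OF _ finite_below[of "real k + 3 * Y"]] finite_subset[OF _ finite_below[of "real k + Y"]])
  have Y4: "4 \<le> Y" using Y100 by simp
  obtain \<Omega>1 where \<Omega>1: "finite \<Omega>1" "\<And>x. x \<in> \<Omega>1 \<Longrightarrow> k \<le> x"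
    "\<And>x. x \<in> \<Omega>1 \<Longrightarrow> 2 * m < card {t. t < m * q \<and> x + t \<in> P1}" "\<rho> * (2 * Y) \<le> real (card \<Omega>1)"
    unfolding \<rho>_def by (rule rich_windows[OF fin(1) _ m(1) q1 mqY Y4 c1, of k]) (auto simp: P1_def)
  obtain \<Omega>3 where \<Omega>3: "finite \<Omega>3" "\<And>x. x \<in> \<Omega>3 \<Longrightarrow> z \<le> x"
    "\<And>x. x \<in> \<Omega>3 \<Longrightarrow> 2 * m < card {t. t < m * q \<and> x + t \<in> P3}" "\<rho> * (2 * Y) \<le> real (card \<Omega>3)"
    unfolding \<rho>_def by (rule rich_windows[OF fin(2) _ m(1) q1 mqY Y4 c3, of z]) (use z in \<open>auto simp: P3_def\<close>)
  have inside: "\<exists>p\<in>Q. x \<le> p" if "2 * m < card {t. t < m * q \<and> x + t \<in> Q}" for x Q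
  proof -
    have "{t. t < m * q \<and> x + t \<in> Q} \<noteq> {}" using that by (metis card.empty not_less0)
    then obtain t where "x + t \<in> Q" by blast
    then show ?thesis by (intro bexI[of _ "x + t"]) auto
  qed
  have mono: "2 * m < card {t. t < m * q \<and> x + t \<in> P1 \<union> P3}" if "2 * m < card {t. t < m * q \<and> x + t \<in> Q}" "Q \<subseteq> P1 \<union> P3" for x Q
    using that(1) by (rule less_le_trans) (use that(2) in \<open>auto intro!: card_mono\<close>)
  have above: "\<exists>a::int. 0 \<le> a * int p - int n \<and> a * int p - int n < int p - int k" if "p \<in> P1 \<union> P3" for p
  proof (rule multiple_above)
    have p: "prime p" "k < p" "real p < real k + 3 * real k powr \<theta>" using that Y100 by (auto simp: P1_def P3_def simp flip: Y_def)
    then show "\<not> p dvd (\<Prod>i=1..k. n - i)" "k < p" using none by auto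
  qed
  then obtain a :: "nat \<Rightarrow> int" where a: "\<And>p. p \<in> P1 \<union> P3 \<Longrightarrow> 0 \<le> a p * int p - int n \<and> a p * int p - int n < int p - int k"
    by metis
  have qm2: "4 \<le> real q ^ 2 * real m"
  proof -
    have "2 ^ 2 * 1 \<le> real q ^ 2 * real m" using q m by (intro mult_mono power_mono) auto
    then show ?thesis by simp
  qed
  have "near_multiples k n m q D g Y \<rho> (P1 \<union> P3) \<Omega>1 \<Omega>3 a"
  proof
    show "real m + 3 \<le> g" using m gm by (simp add: g_def)
    show "g ^ 13 < 2 ^ D"
    proof -
      have "1 / 2 \<le> ln (2::real)" using ln_le_minus_one[of "1 / 2 :: real"] by (simp add: ln_div)
      then have "y * (1 / 2) \<le> y * ln 2" using y by (intro mult_left_mono) auto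
      then have "g ^ 13 < 2 powr y" using y by (simp add: gp powr_def)
      also have "\<dots> \<le> 2 powr real D" using D by (intro powr_mono) auto
      finally show ?thesis by (simp add: powr_realpow)
    qed
    show "0 < \<rho>" "\<rho> \<le> 1" unfolding \<rho>_def using qm2 by (auto simp: divide_le_eq)
    show "real (4096 * D) \<le> \<rho> * g"
      using b(3) qm2 unfolding \<rho>_def by (simp add: field_simps)
    show "real k \<le> real x \<and> real x \<le> real k + Y" if x: "x \<in> \<Omega>1" for x
      using \<Omega>1(2)[OF x] inside[OF \<Omega>1(3)[OF x]] by (auto simp: P1_def)
    show "real k + 19 / 10 * Y \<le> real x \<and> real x \<le> real k + 3 * Y" if x: "x \<in> \<Omega>3" for x
      using \<Omega>3(2)[OF x] inside[OF \<Omega>3(3)[OF x]] z Y100 by (auto simp: P3_def)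
    show "2 * m < card {t. t < m * q \<and> x + t \<in> P1 \<union> P3}" if "x \<in> \<Omega>1 \<union> \<Omega>3" for x
      using that \<Omega>1(3) \<Omega>3(3) mono[of x P1] mono[of x P3] by auto
    show "k < p \<and> real p < real k + 3 * Y" if "p \<in> P1 \<union> P3" for p
      using that Y100 by (auto simp: P1_def P3_def)
  qed (use kg g Yg q1 b wg \<Omega>1 \<Omega>3 a n in auto)
  then interpret W: near_multiples k n m q D g Y \<rho> "P1 \<union> P3" \<Omega>1 \<Omega>3 a .
  have top: "scale n m k \<le> g ^ 70"
  proof -
    have "(ln (real k))\<^sup>2 / (20 * ln (ln (real k))) = y / (20 * ln y) * y" by (simp add: y_def power2_eq_square)
    also have "\<dots> \<le> m * y" using m y by (intro mult_right_mono) auto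
    finally have "real n \<le> exp (m * y)" using n by (meson exp_le_cancel_iff order_trans)
    also have "\<dots> = k ^ m" using k0 by (simp add: exp_of_nat_mult y_def)
    finally have nk: "real n \<le> real k ^ m" by simp
    have "fact m \<le> real m ^ m" by (metis fact_le_power le_refl of_nat_fact of_nat_le_iff of_nat_power)
    also have "\<dots> \<le> real q ^ m" using q by (intro power_mono) auto
    also have "\<dots> = 1 * real q ^ m" by simp
    also have "\<dots> \<le> growth m q" unfolding growth_def by (intro mult_right_mono) auto
    finally have fm: "fact m \<le> g ^ 13" using wg by simp
    have "scale n m k \<le> real k ^ m * g ^ 13 / real k ^ Suc m"
      unfolding scale_def using nk fm k0 by (intro divide_right_mono mult_mono) auto
    also have "\<dots> = g ^ 13 / k" using k0 by simp
    also have "\<dots> \<le> g ^ 13 / 1" using k0 g g1[of 100] kg by (intro divide_left_mono) auto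
    also have "\<dots> \<le> g ^ 70" using gpow[of 13 70] by simp
    finally show ?thesis .
  qed
  have "0 < 16 * Y / q" using Y100 q1 by simp
  then have "0 < real (card P1)" "0 < real (card P3)" using c1 c3 by linarith+
  then have "P1 \<noteq> {}" "P3 \<noteq> {}" by auto
  then obtain p1 p3 where p: "p1 \<in> P1" "p3 \<in> P3" by blast
  show False by (rule W.no_near_multiples[OF top, of p1 p3]) (use p in \<open>auto simp: P1_def P3_def\<close>)
qed

theorem theorem1p1:
  fixes \<theta> :: real
  assumes "2 / 5 < \<theta>" and "\<theta> < 3 / 5"
    and "\<exists>c::real. c > 0 \<and>
      (\<forall>\<^sub>F k::nat in sequentially.
        real (card {p::nat. prime p \<and> k < p \<and> real p < real k + real k powr \<theta>})
          \<ge> c * (real k powr \<theta> / ln (real k)))"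
  shows "\<exists>k0::nat. \<forall>k\<ge>k0. \<forall>n::nat.
    2 * k < n \<and> real n \<le> exp ((ln (real k))\<^sup>2 / (20 * ln (ln (real k)))) \<longrightarrow>
    (\<exists>p::nat. prime p \<and> k < p \<and> real p < real k + 3 * real k powr \<theta> \<and>
      p dvd (\<Prod>i=1..k. n - i))"
proof -
  obtain c K where c: "c > 0" and K: "\<And>k::nat. k \<ge> K \<Longrightarrow>
      real (card {p::nat. prime p \<and> k < p \<and> real p < real k + real k powr \<theta>}) \<ge> c * (real k powr \<theta> / ln (real k))"
    using assms(3) unfolding eventually_sequentially by blast
  have "filterlim (\<lambda>k::nat. ln (real k)) at_top sequentially" by real_asymp
  from eventually_compose_filterlim[OF eventually_parameters[OF c] this]
  obtain K' where K': "\<And>k::nat. k \<ge> K' \<Longrightarrow> (\<lambda>y. 1 < y \<and>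
    ln 6 + 2 * ln (2 * (y / (20 * ln y) + 1) + 1) + 2 * (y / (20 * ln y) + 1) + 3 / 2 * (51 / 50) * ln y * (y / (20 * ln y) + 1) \<le> 8 / 100 * y \<and>
    ln 2 + 2 * ln (2 * (y / (20 * ln y) + 1) + 1) + 3 * (y / (20 * ln y) + 1) + 5 / 2 * (51 / 50) * ln y * (y / (20 * ln y) + 1)
      + ln (y / (20 * ln y) + 1) + 51 / 50 * ln y \<le> 13 / 100 * y \<and>
    ln 2048 + ln (y + 1) + 2 * (51 / 50) * ln y + ln (y / (20 * ln y) + 1) \<le> y / 100 \<and>
    y / (20 * ln y) + 4 \<le> exp (y / 100) \<and> 100 \<le> exp (y / 100) \<and>
    y / (20 * ln y) + 4 \<le> y powr (51 / 50) \<and>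
    32 * y / (y powr (51 / 50) - 1) + 8 * y * exp (- 2 / 5 * y) \<le> c) (ln (real k))"
    unfolding eventually_sequentially by blast
  show ?thesis
  proof (rule exI[of _ "max K K'"], intro allI impI)
    fix k n :: nat
    assume k: "k \<ge> max K K'" and n: "2 * k < n \<and> real n \<le> exp ((ln (real k))\<^sup>2 / (20 * ln (ln (real k))))"
    have "k \<le> nat \<lfloor>real k + 2 * real k powr \<theta>\<rfloor>" by (intro le_nat_floor) simp
    then have Kz: "nat \<lfloor>real k + 2 * real k powr \<theta>\<rfloor> \<ge> K" using k by simp
    have "k \<ge> K" "k \<ge> K'" using k by auto
    note par = K'[OF this(2)]
    show "\<exists>p::nat. prime p \<and> k < p \<and> real p < real k + 3 * real k powr \<theta> \<and> p dvd (\<Prod>i=1..k. n - i)"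
      by (rule prime_divisor_in_short_interval[OF assms(1,2) c]) (use par K[OF \<open>k \<ge> K\<close>] K[OF Kz] n in auto)
  qed
qed

end
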